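(* Let $m\geq0$, $r\geq2$ and $0\leq i\leq r$ be integers. Then \[ \sum_{s_1\geq\dots\geq s_{r}\geq-\lfloor m/2\rfloor}\frac{q^{s_1^2+\dots+s_{r}^2+m(s_1+\dots+s_r)-s_1-\dots-s_i}}{(q)_{s_1-s_2}\cdots(q)_{s_{r-1}-s_r}}(-1)^{s_r}q^{\binom{s_r}{2}}\begin{bmatrix}m+s_r\\ m+2s_r\end{bmatrix} =\sum_{k=0}^{i}q^{mk}\frac{(q^{2r+1},q^{(m+1)r-i+2k},q^{(1-m)r+i-2k+1};q^{2r+1})_\infty}{(q)_\infty}, \] where the sum on the left runs over integers $s_1,\dots,s_r$ and $s_1+\dots+s_i$ is empty (zero) when $i=0$.
   Context: $q$ is a complex number with $|q|<1$. For complex $x$ and base $p$ with $|p|<1$, $(x;p)_\infty=\prod_{j\ge0}(1-xp^j)$, $(x;p)_k=(x;p)_\infty/(xp^k;p)_\infty$ for $k\in\mathbb{Z}$, $(x)_k=(x;q)_k$, and $(x_1,\dots,x_m;p)_\infty=(x_1;p)_\infty\cdots(x_m;p)_\infty$. For integers $N\ge0$ and $j$, $\begin{bmatrix}N\\ j\end{bmatrix}=\frac{(q)_N}{(q)_j(q)_{N-j}}$ if $0\le j\le N$ and $0$ otherwise. *)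

theory Defs
  imports "HOL-Analysis.Analysis"
begin

definition qpoch_inf :: "complex \<Rightarrow> complex \<Rightarrow> complex" where
  "qpoch_inf x p = (\<Prod>j. 1 - x * p ^ j)"

definition qpoch_inf_list :: "complex list \<Rightarrow> complex \<Rightarrow> complex" where
  "qpoch_inf_list xs p = (\<Prod>x\<leftarrow>xs. qpoch_inf x p)"

definition qpoch :: "complex \<Rightarrow> complex \<Rightarrow> int \<Rightarrow> complex" where
  "qpoch x p k = qpoch_inf x p / qpoch_inf (x * p powi k) p"

definition qbinom :: "complex \<Rightarrow> int \<Rightarrow> int \<Rightarrow> complex" where
  "qbinom q N j =
     (if 0 \<le> j \<and> j \<le> N then qpoch q q N / (qpoch q q j * qpoch q q (N - j)) else 0)"

(* A tuple (s_1, ..., s_r) is a function on {1..r}; being extensional (undefined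
   outside {1..r}) makes each tuple occur exactly once in the sum. *)
definition descending_tuples :: "nat \<Rightarrow> nat \<Rightarrow> (nat \<Rightarrow> int) set" where
  "descending_tuples m r =
     {s \<in> extensional {1..r}. (\<forall>j\<in>{1..<r}. s j \<ge> s (j + 1)) \<and> s r \<ge> - int (m div 2)}"

end

theory Submission
  imports Defs
begin

text \<open>
  By the \<open>q\<close>-binomial theorem, \<open>\<beta>_n = (-1)^n q^(n(n-1)/2) [m+n; m+2n]\<close> and \<open>\<alpha>_k = (-1)^k q^(k(k-1)/2)\<close>
  form a bilateral Bailey pair: \<open>\<beta>_n = \<Sum>_k \<alpha>_k / ((q)_(n-k) (q)_(m+n+k))\<close>. Summing over \<open>s_r\<close>, then
  \<open>s_(r-1)\<close>, and so on, is iterating \<open>\<beta> \<mapsto> \<Sum>_l w(l) \<beta>_l / (q)_(n-l)\<close>. For \<open>w(l) = q^(l^2+ml)\<close> the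
  kernel \<open>1 / ((q)_(n-k) (q)_(m+n+k))\<close> is an eigenfunction with eigenvalue \<open>q^(k^2+mk)\<close>, by the
  \<open>q\<close>-Vandermonde sum. For \<open>w(l) = q^(l^2+ml-l)\<close> it is so only modulo the second kernel
  \<open>1 / ((q)_(n-k-1) (q)_(m+n+k))\<close>, and \<open>i\<close> such steps produce the geometric sum
  \<open>\<Sum>_(u\<le>i) q^(u(m+2k))\<close> as \<open>n\<close> tends to infinity. The Jacobi triple product then evaluates the
  \<open>i + 1\<close> resulting theta series.
\<close>

subsection \<open>Summation and exponentiation\<close>

lemma prod_lessThan_add:
  fixes f :: "nat \<Rightarrow> 'a::comm_monoid_mult"
  shows "(\<Prod>i<n + k. f i) = (\<Prod>i<n. f i) * (\<Prod>i<k. f (i + n))"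
  by (induction k) (simp_all add: mult.assoc add.commute)

text \<open>An absolutely convergent \<open>infsum\<close> is an integral against counting measure,
  so this is Lebesgue's theorem; all termwise limits of series below rest on it.\<close>

lemma dominated_convergence_infsum:
  fixes f :: "nat \<Rightarrow> 'a \<Rightarrow> complex"
  assumes lim: "\<And>x. x \<in> A \<Longrightarrow> (\<lambda>n. f n x) \<longlonglongrightarrow> g x"
    and bound: "\<And>n x. x \<in> A \<Longrightarrow> norm (f n x) \<le> w x"
    and w: "w summable_on A"
  shows "(\<lambda>n. infsum (f n) A) \<longlonglongrightarrow> infsum g A" and "g summable_on A"
proof -
  have w0: "0 \<le> w x" if "x \<in> A" for x
    using bound[OF that, of 0] norm_ge_zero order_trans by blast
  have g: "norm (g x) \<le> w x" if "x \<in> A" for x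
    using lim[OF that] bound[OF that] by (intro LIMSEQ_le_const2[OF tendsto_norm]) auto
  have wabs: "Infinite_Sum.abs_summable_on w A"
    using w w0 by (subst summable_on_cong[of A _ w]) auto
  have gs: "Infinite_Sum.abs_summable_on g A"
    by (rule Infinite_Sum.abs_summable_on_comparison_test[OF wabs]) (use g w0 in force)
  have fs: "Infinite_Sum.abs_summable_on (f n) A" for n
    by (rule Infinite_Sum.abs_summable_on_comparison_test[OF wabs]) (use bound w0 in force)
  show "g summable_on A" using gs by (rule abs_summable_summable)
  have eq: "infsum h A = integral\<^sup>L (count_space A) h" if "Infinite_Sum.abs_summable_on h A"
    for h :: "'a \<Rightarrow> complex"
    using infsetsum_infsum[of h A] that by (simp add: infsetsum_def abs_summable_equivalent)
  have "(\<lambda>n. integral\<^sup>L (count_space A) (f n)) \<longlonglongrightarrow> integral\<^sup>L (count_space A) g"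
  proof (rule integral_dominated_convergence[where w = w])
    show "integrable (count_space A) w"
      using wabs unfolding abs_summable_equivalent abs_summable_on_def .
  qed (auto simp: AE_count_space lim bound)
  then show "(\<lambda>n. infsum (f n) A) \<longlonglongrightarrow> infsum g A"
    using eq[OF fs] eq[OF gs] by simp
qed

lemma summable_on_powi_quadratic:
  fixes x :: real and e :: "int \<Rightarrow> int"
  assumes x: "0 < x" "x < 1" and B: "0 \<le> B" and e: "\<And>l. l\<^sup>2 - B * \<bar>l\<bar> \<le> 2 * e l"
  shows "(\<lambda>l. x powi e l) summable_on UNIV"
proof -
  \<comment> \<open>Completing the square in 4 (l^2 - B |l| - 2 |l|) produces this constant; it
    gives e(l) \<ge> |l| - c, hence a geometric majorant on each side.\<close>
  define c where "c = (B + 2)\<^sup>2"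
  have le: "\<bar>l\<bar> - c \<le> e l" for l
  proof -
    have "0 \<le> (\<bar>l\<bar> * 2 - (B + 2))\<^sup>2" by simp
    moreover have "(\<bar>l\<bar> * 2 - (B + 2))\<^sup>2 = 4 * l\<^sup>2 - 4 * (B * \<bar>l\<bar>) - 8 * \<bar>l\<bar> + c"
      by (simp add: c_def power2_diff power_mult_distrib algebra_simps)
    moreover have "0 \<le> c" by (simp add: c_def)
    ultimately show ?thesis using e[of l] by linarith
  qed
  have geo: "(\<lambda>n::nat. x ^ n) summable_on UNIV"
    using x by (subst summable_on_UNIV_nonneg_real_iff) (auto intro: summable_geometric)
  have "(\<lambda>l::int. x ^ nat \<bar>l\<bar>) summable_on (range int \<union> range (\<lambda>n. - int n))"
  proof (rule summable_on_union)
    show "(\<lambda>l::int. x ^ nat \<bar>l\<bar>) summable_on range int"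
      using geo by (subst summable_on_reindex) (auto simp: o_def)
    show "(\<lambda>l::int. x ^ nat \<bar>l\<bar>) summable_on range (\<lambda>n. - int n)"
      using geo by (subst summable_on_reindex) (auto simp: o_def inj_def)
  qed
  moreover have "range int \<union> range (\<lambda>n. - int n) = UNIV"
    by (auto intro: int_cases2)
  ultimately have "(\<lambda>l::int. x powi (- c) * x ^ nat \<bar>l\<bar>) summable_on UNIV"
    by (intro summable_on_cmult_right) simp
  then show ?thesis
  proof (rule summable_on_comparison_test)
    fix l :: int
    have "x powi e l \<le> x powi (\<bar>l\<bar> - c)"
      using x le[of l] by (intro power_int_decreasing) auto
    also have "\<dots> = x powi (- c) * x ^ nat \<bar>l\<bar>"
      using x by (simp add: power_int_diff power_int_minus power_int_nonneg_exp field_simps)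
    finally show "x powi e l \<le> x powi (- c) * x ^ nat \<bar>l\<bar>" .
  qed (use x in auto)
qed

lemma descending_le:
  fixes s :: "nat \<Rightarrow> int"
  assumes "\<And>j. j \<in> {1..<r} \<Longrightarrow> s (j + 1) \<le> s j" and "1 \<le> a" "a \<le> b" "b \<le> r"
  shows "s b \<le> s a"
  using assms(3,4)
proof (induction b rule: dec_induct)
  case (step n)
  then show ?case using assms(1)[of n] assms(2) by auto
qed simp

lemma power_int_sum:
  fixes x :: "'a::field"
  assumes "x \<noteq> 0"
  shows "x powi (\<Sum>j\<in>A. f j) = (\<Prod>j\<in>A. x powi f j)"
  using assms by (induction A rule: infinite_finite_induct) (simp_all add: power_int_add)

subsection \<open>Reciprocal \<open>q\<close>-factorials\<close>

lemma convergent_prod_qpoch: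
  fixes x q :: complex
  assumes "norm q < 1"
  shows "convergent_prod (\<lambda>j. 1 - x * q ^ j)"
proof -
  have "summable (\<lambda>j. norm (1 - x * q ^ j - 1))"
    using assms by (simp add: norm_mult norm_power summable_mult)
  then show ?thesis
    by (intro abs_convergent_prod_imp_convergent_prod summable_imp_abs_convergent_prod)
qed

lemma qpoch_inf_LIMSEQ:
  assumes "norm q < 1"
  shows "(\<lambda>n. \<Prod>j<n. 1 - x * q ^ j) \<longlonglongrightarrow> qpoch_inf x q"
  using convergent_prod_LIMSEQ[OF convergent_prod_qpoch[OF assms, of x]]
  unfolding qpoch_inf_def
  by (subst filterlim_sequentially_Suc[symmetric]) (simp add: lessThan_Suc_atMost)

text \<open>\<open>q \<noteq> 0\<close> makes \<open>powi\<close> additive for negative exponents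
  too. The locale is instantiated again at the base \<open>q ^ (2 * r + 1)\<close>.\<close>

locale nome =
  fixes q :: complex
  assumes q_nonzero: "q \<noteq> 0" and norm_q: "norm q < 1"
begin

text \<open>The convention \<open>1 / (q)_n = 0\<close> for \<open>n < 0\<close> makes all sums below finitely supported, so that
  summation ranges can be shifted and enlarged freely and the tuples need not be assumed descending.\<close>

definition rfac :: "int \<Rightarrow> complex" where
  "rfac n = (if n < 0 then 0 else 1 / (\<Prod>j=1..nat n. 1 - q ^ j))"

lemma one_minus_power_nonzero: "n > 0 \<Longrightarrow> 1 - q ^ n \<noteq> 0"
proof
  assume n: "n > 0" and "1 - q ^ n = 0"
  then have "norm (q ^ n) = 1" by simp
  moreover have "norm q ^ n < 1" using n norm_q power_strict_mono[of "norm q" 1 n] by simp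
  ultimately show False by (simp add: norm_power)
qed

lemma powi_mult: "q powi a * q powi b = q powi (a + b)"
  using q_nonzero by (simp add: power_int_add)

lemma powi_mult_left: "q powi a * (q powi b * x) = q powi (a + b) * x"
  by (simp add: powi_mult flip: mult.assoc)

lemma rfac_neg [simp]: "n < 0 \<Longrightarrow> rfac n = 0"
  by (simp add: rfac_def)

lemma rfac_0 [simp]: "rfac 0 = 1"
  by (simp add: rfac_def)

text \<open>For \<open>n \<le> 0\<close> both sides vanish, so there is no exceptional index and
  recurrences for sums need no boundary cases.\<close>

lemma rfac_rec: "(1 - q powi n) * rfac n = rfac (n - 1)"
proof (cases "n > 0")
  case True
  define k where "k = nat (n - 1)"
  have n: "n = int (Suc k)" using True by (simp add: k_def)
  show ?thesis
    unfolding n using one_minus_power_nonzero[of "Suc k"]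
    by (simp add: rfac_def power_int_add q_nonzero nat_add_distrib del: power_Suc)
       (simp add: power_int_def nat_add_distrib)
qed (cases "n = 0"; simp)

text \<open>The first \<open>n\<close> factors split off the infinite product, and its nonzero tail
  cancels the denominator.\<close>

lemma qpoch_eq_rfac:
  assumes "n \<ge> 0"
  shows "qpoch q q n = 1 / rfac n"
proof -
  define k where "k = nat n"
  have n: "n = int k" using assms by (simp add: k_def)
  have nz: "1 - q * q ^ j \<noteq> 0" for j
    using one_minus_power_nonzero[of "Suc j"] by simp
  have nz': "1 - q * q ^ k * q ^ j \<noteq> 0" for j
    using nz[of "k + j"] by (simp add: power_add mult_ac)
  have "qpoch_inf q q = (\<Prod>i. 1 - q * q ^ (i + k)) * (\<Prod>i<k. 1 - q * q ^ i)"
    unfolding qpoch_inf_def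
    by (rule prodinf_split_initial_segment) (use nz convergent_prod_qpoch[OF norm_q] in auto)
  also have "(\<Prod>i. 1 - q * q ^ (i + k)) = qpoch_inf (q * q ^ k) q"
    by (simp add: qpoch_inf_def power_add mult_ac)
  finally have "qpoch_inf q q = qpoch_inf (q * q ^ k) q * (\<Prod>i<k. 1 - q * q ^ i)" .
  moreover have "qpoch_inf (q * q ^ k) q \<noteq> 0"
    unfolding qpoch_inf_def
    by (rule prodinf_nonzero) (use nz' convergent_prod_qpoch[OF norm_q] in auto)
  moreover have "(\<Prod>i<k. 1 - q * q ^ i) = (\<Prod>j=1..k. 1 - q ^ j)"
    by (rule prod.reindex_bij_witness[of _ "\<lambda>j. j - 1" Suc]) auto
  ultimately show ?thesis
    by (simp add: qpoch_def n rfac_def)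
qed

lemma rfac_nonzero: "n \<ge> 0 \<Longrightarrow> rfac n \<noteq> 0"
  using one_minus_power_nonzero by (auto simp: rfac_def)

lemma qpoch_inf_nonzero: "qpoch_inf q q \<noteq> 0"
  unfolding qpoch_inf_def using one_minus_power_nonzero[of "Suc _"]
  by (intro prodinf_nonzero convergent_prod_qpoch norm_q) simp

lemma rfac_LIMSEQ: "(\<lambda>N. rfac (int N + c)) \<longlonglongrightarrow> 1 / qpoch_inf q q"
proof -
  have "(\<lambda>n. \<Prod>j=1..n. 1 - q ^ j) \<longlonglongrightarrow> qpoch_inf q q"
  proof (rule Lim_transform_eventually[OF qpoch_inf_LIMSEQ[OF norm_q, of q]])
    have "(\<Prod>j<n. 1 - q * q ^ j) = (\<Prod>j=1..n. 1 - q ^ j)" for n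
      by (rule prod.reindex_bij_witness[of _ "\<lambda>j. j - 1" Suc]) auto
    then show "\<forall>\<^sub>F n in sequentially. (\<Prod>j<n. 1 - q * q ^ j) = (\<Prod>j=1..n. 1 - q ^ j)"
      by simp
  qed
  then have "(\<lambda>n. 1 / (\<Prod>j=1..n. 1 - q ^ j)) \<longlonglongrightarrow> 1 / qpoch_inf q q"
    using qpoch_inf_nonzero by (intro tendsto_divide) auto
  then have "(\<lambda>n. rfac (int n)) \<longlonglongrightarrow> 1 / qpoch_inf q q"
    by (simp add: rfac_def)
  then have "(\<lambda>N. rfac (int (N - nat (- c) + nat c))) \<longlonglongrightarrow> 1 / qpoch_inf q q"
    by (rule filterlim_compose)
       (intro filterlim_at_top_mono[OF filterlim_minus_const_nat_at_top[of "nat (- c)"]], simp)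
  then show ?thesis
  proof (rule Lim_transform_eventually)
    show "\<forall>\<^sub>F N in sequentially. rfac (int (N - nat (- c) + nat c)) = rfac (int N + c)"
      using eventually_ge_at_top[of "nat (- c)"]
      by eventually_elim (auto intro!: arg_cong[of _ _ rfac])
  qed
qed

text \<open>The constant in every dominating function below: a convergent sequence is
  bounded.\<close>

lemma rfac_bounded: obtains C where "C > 0" "\<And>n. norm (rfac n) \<le> C"
proof -
  have "Bseq (\<lambda>N. rfac (int N + 0))"
    using rfac_LIMSEQ convergentI convergent_imp_Bseq by blast
  then obtain C where C: "C > 0" "\<And>N. norm (rfac (int N + 0)) \<le> C"
    by (auto elim: BseqE)
  have "norm (rfac n) \<le> C" for n
    using C(1) C(2)[of "nat n"] by (cases "n < 0") auto
  then show ?thesis using C(1) that by blast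
qed

subsection \<open>The \<open>q\<close>-Vandermonde sum and the \<open>q\<close>-binomial theorem\<close>

text \<open>Induction for all \<open>M\<close> at once. With N = n + 1, write 1 - q^N = (1 -
  q^(N-l)) + q^(N-l) (1 - q^l), each bracket lowering one factorial: the first part is the case
  \<open>n\<close> with \<open>M\<close>, the second, shifted in \<open>l\<close>, the case
  \<open>n\<close> with \<open>M + 1\<close>.\<close>

lemma q_Vandermonde_nat:
  "(\<Sum>l=0..int n. q powi (l\<^sup>2 + M * l) * rfac (int n - l) * rfac l * rfac (M + l))
     = rfac (int n) * rfac (M + int n)"
proof (induction n arbitrary: M)
  case (Suc n)
  let ?N = "int (Suc n)"
  let ?t = "\<lambda>M n l. q powi (l\<^sup>2 + M * l) * rfac (n - l) * rfac l * rfac (M + l)"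
  have split: "(1 - q powi ?N) * ?t M ?N l
      = ?t M (int n) l + q powi (?N + l\<^sup>2 + (M - 1) * l) * rfac (?N - l) * rfac (l - 1) * rfac (M + l)" for l
  proof -
    have 1: "rfac (int n - l) = (1 - q powi (?N - l)) * rfac (?N - l)"
      using rfac_rec[of "?N - l"] by (simp add: algebra_simps)
    have 2: "rfac (l - 1) = (1 - q powi l) * rfac l"
      by (rule rfac_rec[symmetric])
    have 3: "q powi (?N + l\<^sup>2 + (M - 1) * l) = q powi (?N - l) * q powi (l\<^sup>2 + M * l)"
      by (simp add: powi_mult algebra_simps)
    have 4: "q powi ?N = q powi (?N - l) * q powi l"
      by (simp add: powi_mult del: of_nat_Suc)
    show ?thesis unfolding 1 2 3 4 by (simp add: algebra_simps del: of_nat_Suc)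
  qed
  have I1: "(\<Sum>l=0..?N. ?t M (int n) l) = rfac (int n) * rfac (M + int n)"
  proof -
    have "(\<Sum>l=0..?N. ?t M (int n) l) = (\<Sum>l=0..int n. ?t M (int n) l)"
      by (rule sum.mono_neutral_right) auto
    then show ?thesis using Suc.IH by simp
  qed
  have I2: "(\<Sum>l=0..?N. q powi (?N + l\<^sup>2 + (M - 1) * l) * rfac (?N - l) * rfac (l - 1) * rfac (M + l))
        = q powi (?N + M) * (rfac (int n) * rfac (M + 1 + int n))"
  proof -
    have "(\<Sum>l=0..?N. q powi (?N + l\<^sup>2 + (M - 1) * l) * rfac (?N - l) * rfac (l - 1) * rfac (M + l))
      = (\<Sum>l=1..?N. q powi (?N + l\<^sup>2 + (M - 1) * l) * rfac (?N - l) * rfac (l - 1) * rfac (M + l))"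
      by (rule sum.mono_neutral_right) auto
    also have "\<dots> = (\<Sum>l=0..int n. q powi (?N + (l + 1)\<^sup>2 + (M - 1) * (l + 1)) * rfac (int n - l) * rfac l * rfac (M + 1 + l))"
      by (rule sum.reindex_bij_witness[of _ "\<lambda>l. l + 1" "\<lambda>l. l - 1"]) (auto simp: algebra_simps)
    also have "\<dots> = (\<Sum>l=0..int n. q powi (?N + M) * ?t (M + 1) (int n) l)"
    proof (rule sum.cong)
      fix l :: int
      have "q powi (?N + (l + 1)\<^sup>2 + (M - 1) * (l + 1)) = q powi (?N + M) * q powi (l\<^sup>2 + (M + 1) * l)"
        by (simp add: powi_mult algebra_simps power2_eq_square)
      then show "q powi (?N + (l + 1)\<^sup>2 + (M - 1) * (l + 1)) * rfac (int n - l) * rfac l * rfac (M + 1 + l)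
          = q powi (?N + M) * ?t (M + 1) (int n) l"
        by (simp only: mult.assoc)
    qed simp
    finally show ?thesis by (simp only: sum_distrib_left[symmetric] Suc.IH)
  qed
  have "(1 - q powi ?N) * (\<Sum>l=0..?N. ?t M ?N l)
      = rfac (int n) * rfac (M + int n) + q powi (?N + M) * (rfac (int n) * rfac (M + 1 + int n))"
    unfolding sum_distrib_left split sum.distrib I1 I2 ..
  also have "rfac (M + int n) = (1 - q powi (?N + M)) * rfac (M + ?N)"
    using rfac_rec[of "M + ?N"] by (simp add: algebra_simps)
  also have "M + 1 + int n = M + ?N" by simp
  also have "rfac (int n) = (1 - q powi ?N) * rfac ?N"
    using rfac_rec[of ?N] by simp
  finally have E: "(1 - q powi ?N) * (\<Sum>l=0..?N. ?t M ?N l) = (1 - q powi ?N) * (rfac ?N * rfac (M + ?N))"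
    by (simp add: algebra_simps del: of_nat_Suc)
  have "1 - q powi ?N \<noteq> 0"
    using one_minus_power_nonzero[of "Suc n"] by (simp del: of_nat_Suc)
  from mult_left_cancel[THEN iffD1, OF this E] show ?case .
qed simp

text \<open>The splitting of \<open>q_Vandermonde_nat\<close> again: after a shift of
  \<open>j\<close> the second part is -z q^P times the first, which creates the factor 1 - z
  q^P.\<close>

lemma q_binomial_theorem:
  "(\<Sum>j=0..int P. (-1) powi j * q powi (j * (j - 1) div 2) * z powi j * rfac j * rfac (int P - j))
     = rfac (int P) * (\<Prod>i<P. 1 - z * q ^ i)"
  if z: "z \<noteq> 0"
proof (induction P)
  case (Suc P)
  let ?N = "int (Suc P)"
  let ?c = "\<lambda>j. (-1) powi j * q powi (j * (j - 1) div 2) * z powi j :: complex"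
  let ?t = "\<lambda>P j. ?c j * rfac j * rfac (P - j)"
  have split: "(1 - q powi ?N) * ?t ?N j
      = ?t (int P) j + q powi (?N - j) * ?c j * rfac (j - 1) * rfac (?N - j)" for j
  proof -
    have 1: "rfac (int P - j) = (1 - q powi (?N - j)) * rfac (?N - j)"
      using rfac_rec[of "?N - j"] by (simp add: algebra_simps)
    have 2: "rfac (j - 1) = (1 - q powi j) * rfac j"
      by (rule rfac_rec[symmetric])
    have 4: "q powi ?N = q powi (?N - j) * q powi j"
      by (simp add: powi_mult del: of_nat_Suc)
    show ?thesis unfolding 1 2 4 by (simp add: algebra_simps del: of_nat_Suc)
  qed
  have shift: "q powi (int P - j) * ?c (j + 1) = - z * q ^ P * ?c j" for j
  proof -
    have "(j + 1) * (j + 1 - 1) = 2 * j + j * (j - 1)" by (simp add: algebra_simps)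
    then have "(j + 1) * (j + 1 - 1) div 2 = j + j * (j - 1) div 2" by simp
    then have "q powi (int P - j) * q powi ((j + 1) * (j + 1 - 1) div 2) = q ^ P * q powi (j * (j - 1) div 2)"
      by (simp add: powi_mult flip: power_int_of_nat)
    moreover have "(-1) powi (j + 1) = - ((-1) powi j :: complex)" by (simp add: power_int_add)
    moreover have "z powi (j + 1) = z powi j * z" using z by (simp add: power_int_add)
    ultimately show ?thesis by (simp add: mult_ac)
  qed
  have I1: "(\<Sum>j=0..?N. ?t (int P) j) = (\<Sum>j=0..int P. ?t (int P) j)"
    by (rule sum.mono_neutral_right) auto
  have I2: "(\<Sum>j=0..?N. q powi (?N - j) * ?c j * rfac (j - 1) * rfac (?N - j))
        = - z * q ^ P * (\<Sum>j=0..int P. ?t (int P) j)"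
  proof -
    have "(\<Sum>j=0..?N. q powi (?N - j) * ?c j * rfac (j - 1) * rfac (?N - j))
      = (\<Sum>j=1..?N. q powi (?N - j) * ?c j * rfac (j - 1) * rfac (?N - j))"
      by (rule sum.mono_neutral_right) auto
    also have "\<dots> = (\<Sum>j=0..int P. q powi (int P - j) * ?c (j + 1) * rfac j * rfac (int P - j))"
      by (rule sum.reindex_bij_witness[of _ "\<lambda>l. l + 1" "\<lambda>l. l - 1"]) (auto simp: algebra_simps)
    also have "\<dots> = (\<Sum>j=0..int P. - z * q ^ P * ?t (int P) j)"
      unfolding shift by (simp add: mult_ac)
    finally show ?thesis unfolding sum_distrib_left .
  qed
  have "(1 - q powi ?N) * (\<Sum>j=0..?N. ?t ?N j)
      = (\<Sum>j=0..int P. ?t (int P) j) + - z * q ^ P * (\<Sum>j=0..int P. ?t (int P) j)"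
    by (subst sum_distrib_left) (simp only: split sum.distrib I1 I2)
  also have "\<dots> = (1 - z * q ^ P) * (\<Sum>j=0..int P. ?t (int P) j)"
    by (simp only: left_diff_distrib mult_1 mult_minus_left) simp
  also have "\<dots> = (1 - z * q ^ P) * (rfac (int P) * (\<Prod>i<P. 1 - z * q ^ i))"
    unfolding Suc.IH ..
  also have "rfac (int P) = (1 - q powi ?N) * rfac ?N"
    using rfac_rec[of ?N] by simp
  finally have E: "(1 - q powi ?N) * (\<Sum>j=0..?N. ?t ?N j)
      = (1 - q powi ?N) * (rfac ?N * (\<Prod>i<Suc P. 1 - z * q ^ i))"
    by (simp add: algebra_simps del: of_nat_Suc)
  have "1 - q powi ?N \<noteq> 0"
    using one_minus_power_nonzero[of "Suc P"] by (simp del: of_nat_Suc)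
  from mult_left_cancel[THEN iffD1, OF this E] show ?case .
qed simp

text \<open>Shifting \<open>l\<close> by \<open>k\<close> reduces to
  \<open>q_Vandermonde_nat\<close> with \<open>M + 2 * k\<close>. Starting at \<open>L\<close> loses
  nothing: k \<le> l < L forces M + l + k < 0.\<close>

lemma q_Vandermonde:
  assumes L: "2 * L \<le> 1 - M"
  shows "(\<Sum>l=L..n. q powi (l\<^sup>2 + M * l) * rfac (n - l) * (rfac (l - k) * rfac (M + l + k)))
     = q powi (k\<^sup>2 + M * k) * (rfac (n - k) * rfac (M + n + k))"
proof (cases "n < k")
  case True
  then show ?thesis by (intro sum.neutral[THEN trans]) auto
next
  case False
  define p where "p = nat (n - k)"
  have n: "n = k + int p" using False by (simp add: p_def)
  have "(\<Sum>l=L..n. q powi (l\<^sup>2 + M * l) * rfac (n - l) * (rfac (l - k) * rfac (M + l + k)))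
      = (\<Sum>l=k..n. q powi (l\<^sup>2 + M * l) * rfac (n - l) * (rfac (l - k) * rfac (M + l + k)))"
  proof (rule sum.mono_neutral_cong)
    fix l assume "l \<in> {k..n} - {L..n}"
    then have "M + l + k < 0" using L by auto
    then show "q powi (l\<^sup>2 + M * l) * rfac (n - l) * (rfac (l - k) * rfac (M + l + k)) = 0" by simp
  qed auto
  also have "\<dots> = (\<Sum>l=0..int p. q powi (k\<^sup>2 + M * k) *
      (q powi (l\<^sup>2 + (M + 2 * k) * l) * rfac (int p - l) * rfac l * rfac (M + 2 * k + l)))"
  proof (rule sum.reindex_bij_witness[of _ "\<lambda>l. l + k" "\<lambda>l. l - k"])
    fix l assume "l \<in> {k..n}"
    have "q powi (l\<^sup>2 + M * l) = q powi (k\<^sup>2 + M * k) * q powi ((l - k)\<^sup>2 + (M + 2 * k) * (l - k))"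
      by (simp add: powi_mult algebra_simps power2_eq_square)
    moreover have "int p - (l - k) = n - l" "M + 2 * k + (l - k) = M + l + k" using n by auto
    ultimately show "q powi (k\<^sup>2 + M * k) * (q powi ((l - k)\<^sup>2 + (M + 2 * k) * (l - k))
        * rfac (int p - (l - k)) * rfac (l - k) * rfac (M + 2 * k + (l - k)))
      = q powi (l\<^sup>2 + M * l) * rfac (n - l) * (rfac (l - k) * rfac (M + l + k))"
      by (simp only: mult.assoc)
  qed (auto simp: n)
  also have "\<dots> = q powi (k\<^sup>2 + M * k) * (rfac (int p) * rfac (M + 2 * k + int p))"
    by (simp only: sum_distrib_left[symmetric] q_Vandermonde_nat)
  finally show ?thesis by (simp add: n algebra_simps)
qed

section \<open>The bilateral Bailey pair\<close>

definition theta_coeff :: "int \<Rightarrow> complex" where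
  "theta_coeff k = (-1) powi k * q powi (k * (k - 1) div 2)"

text \<open>The substitution k = N - j leads to the q-binomial theorem at q^(1-N)/z. Used with z = 1
  for the Bailey pair and with N = M for the triple product.\<close>

lemma q_binomial_shifted:
  assumes P: "N + M = int P" and z: "z \<noteq> 0"
  shows "(\<Sum>k=-M..N. theta_coeff k * z powi k * (rfac (N - k) * rfac (M + k)))
    = theta_coeff N * z powi N * rfac (int P) * (\<Prod>i<P. 1 - q powi (1 - N + int i) / z)"
proof -
  define y where "y = q powi (1 - N) / z"
  have y: "y \<noteq> 0" using z q_nonzero by (simp add: y_def)
  have "(\<Sum>k=-M..N. theta_coeff k * z powi k * (rfac (N - k) * rfac (M + k)))
    = (\<Sum>j=0..int P. theta_coeff N * z powi N *
       ((-1) powi j * q powi (j * (j - 1) div 2) * y powi j * rfac j * rfac (int P - j)))"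
  proof (rule sum.reindex_bij_witness[of _ "\<lambda>j. N - j" "\<lambda>k. N - k"])
    fix k
    define j where "j = N - k"
    have k: "k = N - j" by (simp add: j_def)
    have "(N - j) * (N - j - 1) = 2 * (j * (1 - N)) + (N * (N - 1) + j * (j - 1))"
      by (simp add: algebra_simps)
    moreover have "even (N * (N - 1))" "even (j * (j - 1))" by auto
    ultimately have "(N - j) * (N - j - 1) div 2 = j * (1 - N) + (N * (N - 1) div 2 + j * (j - 1) div 2)"
      by (simp add: div_plus_div_distrib_dvd_left)
    then have "q powi (k * (k - 1) div 2)
        = q powi (j * (1 - N)) * (q powi (N * (N - 1) div 2) * q powi (j * (j - 1) div 2))"
      by (simp add: k powi_mult)
    moreover have "(-1) powi k = (-1) powi N * ((-1) powi j :: complex)"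
      by (simp add: k power_int_diff) (auto simp: power_int_minus_left)
    moreover have "z powi k = z powi N / z powi j" using z by (simp add: k power_int_diff)
    moreover have "y powi j = q powi (j * (1 - N)) / z powi j"
      by (simp add: y_def power_int_divide_distrib mult.commute[of j] flip: power_int_mult)
    moreover have "int P - (N - k) = M + k" using P by simp
    ultimately show "theta_coeff N * z powi N *
       ((-1) powi (N - k) * q powi ((N - k) * (N - k - 1) div 2) * y powi (N - k) * rfac (N - k) * rfac (int P - (N - k)))
      = theta_coeff k * z powi k * (rfac (N - k) * rfac (M + k))"
      by (simp add: theta_coeff_def flip: j_def)
  qed (use P in auto)
  also have "\<dots> = theta_coeff N * z powi N * (rfac (int P) * (\<Prod>i<P. 1 - y * q ^ i))"
    by (simp only: sum_distrib_left[symmetric] q_binomial_theorem[OF y])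
  also have "(\<Prod>i<P. 1 - y * q ^ i) = (\<Prod>i<P. 1 - q powi (1 - N + int i) / z)"
    by (intro prod.cong refl) (simp add: y_def flip: powi_mult)
  finally show ?thesis by (simp only: mult.assoc)
qed

lemma rfac_add: "rfac c = rfac (c + int P) * (\<Prod>i<P. 1 - q powi (1 + c + int i))"
proof (induction P)
  case (Suc P)
  have "rfac (c + int P) = (1 - q powi (1 + c + int P)) * rfac (c + int (Suc P))"
    using rfac_rec[of "c + int (Suc P)"] by (simp add: algebra_simps)
  then show ?case using Suc.IH by (simp add: mult_ac)
qed simp

text \<open>\<open>q_binomial_shifted\<close> at z = 1 yields the product of 1 - q^(1-n+i) over i <
  m + 2n. For n > 0 its factor at i = n - 1 is 0, and so is the q-binomial coefficient; for n \<le>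
  0 \<open>rfac_add\<close> makes it a quotient of factorials.\<close>

lemma bailey_beta_eq:
  fixes m :: nat
  shows "theta_coeff n * qbinom q (int m + n) (int m + 2 * n)
    = (\<Sum>k=-int m-n..n. theta_coeff k * (rfac (n - k) * rfac (int m + n + k)))"
proof (cases "int m + 2 * n < 0")
  case True
  then show ?thesis by (simp add: qbinom_def)
next
  case False
  define P where "P = nat (int m + 2 * n)"
  have P: "n + (int m + n) = int P" using False by (simp add: P_def)
  have eq: "(\<Sum>k=-int m-n..n. theta_coeff k * (rfac (n - k) * rfac (int m + n + k)))
      = theta_coeff n * (rfac (int P) * (\<Prod>i<P. 1 - q powi (1 - n + int i)))"
    using q_binomial_shifted[OF P, of 1] by (simp add: mult.assoc)
  show ?thesis
  proof (cases "n > 0")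
    case True
    have "q powi (1 - n + int (nat (n - 1))) = 1" using True by simp
    moreover have "nat (n - 1) < P" using True False by (simp add: P_def)
    ultimately have "(\<Prod>i<P. 1 - q powi (1 - n + int i)) = 0"
      by (subst prod_zero_iff) (auto intro!: bexI[of _ "nat (n - 1)"])
    then show ?thesis unfolding eq using True by (simp add: qbinom_def)
  next
    case n: False
    have "rfac (- n) = rfac (int m + n) * (\<Prod>i<P. 1 - q powi (1 - n + int i))"
      using rfac_add[of "- n" P] by (simp add: P[symmetric] add.commute)
    moreover have "rfac (int m + n) \<noteq> 0" using n False by (intro rfac_nonzero) auto
    moreover have "qbinom q (int m + n) (int m + 2 * n) = rfac (int P) * rfac (- n) / rfac (int m + n)"
    proof -
      have "int P = int m + 2 * n" using P by auto
      then show ?thesis using n False by (simp add: qbinom_def qpoch_eq_rfac)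
    qed
    ultimately show ?thesis unfolding eq by simp
  qed
qed

subsection \<open>The Jacobi triple product\<close>

lemma theta_coeff_Suc: "theta_coeff (int (Suc n)) = - (q ^ n) * theta_coeff (int n)"
proof -
  have "int (Suc n) * (int (Suc n) - 1) = 2 * int n + int n * (int n - 1)"
    by (simp add: algebra_simps)
  then have "int (Suc n) * (int (Suc n) - 1) div 2 = int n + int n * (int n - 1) div 2"
    by simp
  then show ?thesis
    by (simp add: theta_coeff_def power_int_add q_nonzero)
qed

text \<open>The 2n factors from \<open>q_binomial_shifted\<close> form two halves. Those with
  exponents 1 - n, ..., 0 absorb the coefficient of z^n, by -q^i z (1 - q^(-i)/z) = 1 - z q^i; the
  others already are the product in q/z.\<close>

lemma finite_Jacobi:
  assumes z: "z \<noteq> 0"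
  shows "(\<Sum>k=-int n..int n. theta_coeff k * z powi k * (rfac (int n - k) * rfac (int n + k)))
    = rfac (int (2 * n)) * ((\<Prod>j<n. 1 - z * q ^ j) * (\<Prod>j<n. 1 - q / z * q ^ j))"
proof -
  have "(\<Prod>i<2 * n. 1 - q powi (1 - int n + int i) / z)
      = (\<Prod>i<n. 1 - q powi (1 - int n + int i) / z) * (\<Prod>i<n. 1 - q powi (1 - int n + int (i + n)) / z)"
    unfolding mult_2 by (rule prod_lessThan_add)
  also have "(\<Prod>i<n. 1 - q powi (1 - int n + int (i + n)) / z) = (\<Prod>j<n. 1 - q / z * q ^ j)"
    by (simp add: power_int_add q_nonzero)
  also have "(\<Prod>i<n. 1 - q powi (1 - int n + int i) / z) = (\<Prod>i<n. 1 - q powi (- int (n - Suc i)) / z)"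
    by (intro prod.cong) (auto simp: of_nat_diff algebra_simps)
  also have "\<dots> = (\<Prod>i<n. 1 - q powi (- int i) / z)"
    by (rule prod.nat_diff_reindex)
  finally have 1: "(\<Prod>i<2 * n. 1 - q powi (1 - int n + int i) / z)
      = (\<Prod>i<n. 1 - q powi (- int i) / z) * (\<Prod>j<n. 1 - q / z * q ^ j)" .
  have 2: "theta_coeff (int n) * z ^ n * (\<Prod>i<n. 1 - q powi (- int i) / z) = (\<Prod>j<n. 1 - z * q ^ j)"
  proof (induction n)
    case (Suc n)
    have "- (q ^ n) * z * (1 - q powi (- int n) / z) = 1 - z * q ^ n"
      using z q_nonzero by (simp add: power_int_minus field_simps)
    then show ?case using Suc.IH
      by (simp add: theta_coeff_Suc mult_ac del: of_nat_Suc)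
         (metis (no_types, lifting) mult.assoc mult.commute mult_minus_right)
  qed (simp add: theta_coeff_def)
  show ?thesis
    using q_binomial_shifted[of "int n" "int n" "2 * n" z] z unfolding 1 2[symmetric]
    by (simp add: mult_ac)
qed

lemma summable_on_theta:
  assumes z: "z \<noteq> 0"
  shows "(\<lambda>k. norm (theta_coeff k * z powi k)) summable_on UNIV"
proof -
  \<comment> \<open>\<open>b\<close> is chosen so that |z^k| \<le> |q|^(-b |k|) for k of either
    sign; the quadratic exponent of \<open>theta_coeff\<close> absorbs this linear loss.\<close>
  have "0 < min (norm z) (1 / norm z)" using z by simp
  then obtain b where b: "norm q ^ b < min (norm z) (1 / norm z)"
    using real_arch_pow_inv norm_q by blast
  have nq: "norm q > 0" using q_nonzero by simp
  define y where "y = norm q powi (- int b)"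
  have y: "norm z \<le> y" "inverse (norm z) \<le> y"
    using b z nq by (auto simp: y_def power_int_minus field_simps less_imp_le)
  have zy: "norm (z powi k) \<le> y powi \<bar>k\<bar>" for k
  proof (cases "k \<ge> 0")
    case True
    then show ?thesis using y by (simp add: norm_power_int power_int_mono)
  next
    case False
    have "norm (z powi k) = inverse (norm z) powi (- k)"
      by (simp add: norm_power_int power_int_inverse power_int_minus)
    also have "\<dots> \<le> y powi (- k)" using y False by (intro power_int_mono) auto
    finally show ?thesis using False by simp
  qed
  have "(\<lambda>k. norm q powi (k * (k - 1) div 2 - int b * \<bar>k\<bar>)) summable_on UNIV"
  proof (rule summable_on_powi_quadratic[where B = "2 * int b + 1"])
    fix k :: int
    have "2 * (k * (k - 1) div 2) = k * (k - 1)" by simp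
    then show "k\<^sup>2 - (2 * int b + 1) * \<bar>k\<bar> \<le> 2 * (k * (k - 1) div 2 - int b * \<bar>k\<bar>)"
      by (simp add: algebra_simps power2_eq_square)
  qed (use nq norm_q in auto)
  then show ?thesis
  proof (rule summable_on_comparison_test)
    fix k :: int
    have "norm (theta_coeff k * z powi k) = norm q powi (k * (k - 1) div 2) * norm (z powi k)"
      by (simp add: theta_coeff_def norm_mult norm_power_int)
    also have "\<dots> \<le> norm q powi (k * (k - 1) div 2) * y powi \<bar>k\<bar>"
      using zy by (intro mult_left_mono) auto
    also have "\<dots> = norm q powi (k * (k - 1) div 2 - int b * \<bar>k\<bar>)"
      using nq by (simp add: y_def flip: power_int_mult power_int_add)
    finally show "norm (theta_coeff k * z powi k) \<le> norm q powi (k * (k - 1) div 2 - int b * \<bar>k\<bar>)" .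
  qed auto
qed

text \<open>The limit of \<open>finite_Jacobi\<close>, taken under the sum. Each term acquires
  1/(q)_inf^2 while the right side has a single 1/(q)_inf, which accounts for the factor
  \<open>qpoch_inf q q\<close>.\<close>

lemma Jacobi_triple_product:
  assumes z: "z \<noteq> 0"
  shows "((\<lambda>k. theta_coeff k * z powi k) has_sum (qpoch_inf q q * qpoch_inf z q * qpoch_inf (q / z) q)) UNIV"
proof -
  let ?a = "\<lambda>k. theta_coeff k * z powi k"
  let ?f = "\<lambda>n k. ?a k * (rfac (int n - k) * rfac (int n + k))"
  obtain C where C: "C > 0" "\<And>n. norm (rfac n) \<le> C" using rfac_bounded by blast
  have lim: "(\<lambda>n. ?f n k) \<longlonglongrightarrow> ?a k * (1 / qpoch_inf q q * (1 / qpoch_inf q q))" for k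
    using rfac_LIMSEQ[of "- k"] rfac_LIMSEQ[of k] by (intro tendsto_intros) auto
  have bound: "norm (?f n k) \<le> norm (?a k) * (C * C)" for n k
    using C by (subst norm_mult, subst norm_mult) (intro mult_left_mono mult_mono, auto)
  have w: "(\<lambda>k. norm (?a k) * (C * C)) summable_on UNIV"
    by (intro summable_on_cmult_left summable_on_theta z)
  have inf: "infsum (?f n) UNIV = rfac (int (2 * n)) * ((\<Prod>j<n. 1 - z * q ^ j) * (\<Prod>j<n. 1 - q / z * q ^ j))" for n
  proof -
    have "infsum (?f n) UNIV = infsum (?f n) {-int n..int n}"
      by (rule infsum_cong_neutral) auto
    then show ?thesis using finite_Jacobi[OF z] by simp
  qed
  have sq: "(\<lambda>n. rfac (int (2 * n))) \<longlonglongrightarrow> 1 / qpoch_inf q q"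
    using LIMSEQ_subseq_LIMSEQ[OF rfac_LIMSEQ[of 0], of "\<lambda>n. 2 * n"]
    by (simp add: strict_mono_def o_def)
  have "(\<lambda>n. infsum (?f n) UNIV) \<longlonglongrightarrow> 1 / qpoch_inf q q * (qpoch_inf z q * qpoch_inf (q / z) q)"
    unfolding inf by (intro tendsto_intros sq qpoch_inf_LIMSEQ norm_q)
  moreover have "(\<lambda>n. infsum (?f n) UNIV) \<longlonglongrightarrow> (\<Sum>\<^sub>\<infinity>k. ?a k * (1 / qpoch_inf q q * (1 / qpoch_inf q q)))"
    by (rule dominated_convergence_infsum(1)[OF lim bound w])
  ultimately have "(\<Sum>\<^sub>\<infinity>k. ?a k * (1 / qpoch_inf q q * (1 / qpoch_inf q q)))
      = 1 / qpoch_inf q q * (qpoch_inf z q * qpoch_inf (q / z) q)"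
    using LIMSEQ_unique by blast
  moreover have "(\<Sum>\<^sub>\<infinity>k. ?a k * (1 / qpoch_inf q q * (1 / qpoch_inf q q)))
      = infsum ?a UNIV * (1 / qpoch_inf q q * (1 / qpoch_inf q q))"
    by (rule infsum_cmult_left')
  ultimately have "infsum ?a UNIV = qpoch_inf q q * qpoch_inf z q * qpoch_inf (q / z) q"
    using qpoch_inf_nonzero by (simp add: field_simps)
  moreover have "?a summable_on UNIV"
    using summable_on_theta[OF z] by (rule abs_summable_summable)
  ultimately show ?thesis by (metis has_sum_infsum)
qed

subsection \<open>Iterated Bailey steps\<close>

definition bailey_step :: "int \<Rightarrow> (int \<Rightarrow> complex) \<Rightarrow> (int \<Rightarrow> complex) \<Rightarrow> int \<Rightarrow> complex" where
  "bailey_step L w \<beta> n = (\<Sum>l=L..n. w l * rfac (n - l) * \<beta> l)"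

text \<open>The weight with the highest index acts first: s_r is the innermost summation variable,
  s_1 the last to be summed.\<close>

primrec bailey_iter :: "int \<Rightarrow> (nat \<Rightarrow> int \<Rightarrow> complex) \<Rightarrow> nat \<Rightarrow> (int \<Rightarrow> complex) \<Rightarrow> int \<Rightarrow> complex" where
  "bailey_iter L w 0 \<beta> = \<beta>"
| "bailey_iter L w (Suc r) \<beta> = bailey_iter L w r (bailey_step L (w (Suc r)) \<beta>)"

text \<open>The update \<open>s(0 := N)\<close> supplies s_0 = N, so that 1/(q)_(N-s_1) looks like
  the other factors and r = 0 returns \<open>\<beta> N\<close>. The induction sums out the last
  coordinate, replacing \<open>\<beta>\<close> by its Bailey step.\<close>

lemma bailey_iter_eq_sum:
  "(\<Sum>s\<in>PiE {1..r} (\<lambda>_. {L..N}). (\<Prod>j=1..r. w j (s j) * rfac ((s(0 := N)) (j - 1) - s j))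
      * \<beta> ((s(0 := N)) r)) = bailey_iter L w r \<beta> N"
proof (induction r arbitrary: \<beta>)
  case (Suc r)
  let ?A = "PiE {1..r} (\<lambda>_. {L..N})"
  let ?F = "\<lambda>r s. \<Prod>j=1..r. w j (s j) * rfac ((s(0 := N)) (j - 1) - s j)"
  have "{1..Suc r} = insert (Suc r) {1..r}" by auto
  then have pi: "PiE {1..Suc r} (\<lambda>_. {L..N}) = (\<lambda>(y, g). g(Suc r := y)) ` ({L..N} \<times> ?A)"
    by (simp only: PiE_insert_eq)
  have inj: "inj_on (\<lambda>(y, g). g(Suc r := y)) ({L..N} \<times> ?A)"
    by (rule inj_combinator) simp
  have summand: "?F (Suc r) (g(Suc r := y)) * \<beta> (((g(Suc r := y))(0 := N)) (Suc r))
      = ?F r g * (w (Suc r) y * rfac ((g(0 := N)) r - y) * \<beta> y)" for g y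
  proof -
    have "(\<Prod>j=1..r. w j ((g(Suc r := y)) j) * rfac (((g(Suc r := y))(0 := N)) (j - 1) - (g(Suc r := y)) j)) = ?F r g"
      by (rule prod.cong) auto
    then show ?thesis by (simp add: mult_ac)
  qed
  \<comment> \<open>The box lets y run up to \<open>N\<close>, a Bailey step only up to s_r; the
    surplus terms contain \<open>rfac\<close> at a negative argument.\<close>
  have inner: "(\<Sum>y\<in>{L..N}. w (Suc r) y * rfac ((g(0 := N)) r - y) * \<beta> y)
      = bailey_step L (w (Suc r)) \<beta> ((g(0 := N)) r)" if "g \<in> ?A" for g
  proof -
    have "(g(0 := N)) r \<le> N" using that by (cases r) (auto simp: PiE_def Pi_def)
    then show ?thesis unfolding bailey_step_def by (intro sum.mono_neutral_right) auto
  qed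
  have "(\<Sum>s\<in>PiE {1..Suc r} (\<lambda>_. {L..N}). ?F (Suc r) s * \<beta> ((s(0 := N)) (Suc r)))
      = (\<Sum>(y, g)\<in>{L..N} \<times> ?A. ?F r g * (w (Suc r) y * rfac ((g(0 := N)) r - y) * \<beta> y))"
    unfolding pi sum.reindex[OF inj]
    by (rule sum.cong[OF refl]) (clarsimp simp only: o_apply case_prod_conv summand)
  also have "\<dots> = (\<Sum>g\<in>?A. \<Sum>y\<in>{L..N}. ?F r g * (w (Suc r) y * rfac ((g(0 := N)) r - y) * \<beta> y))"
    by (subst sum.cartesian_product[symmetric], rule sum.swap)
  also have "\<dots> = (\<Sum>g\<in>?A. ?F r g * bailey_step L (w (Suc r)) \<beta> ((g(0 := N)) r))"
    by (intro sum.cong refl) (simp only: sum_distrib_left[symmetric] inner)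
  also have "\<dots> = bailey_iter L w r (bailey_step L (w (Suc r)) \<beta>) N"
    by (rule Suc.IH)
  finally show ?case by simp
qed simp

text \<open>The outer factor 1/(q)_(N-s_1) is left out, being the only factor that depends on
  \<open>N\<close>.\<close>

definition tuple_term :: "(nat \<Rightarrow> int \<Rightarrow> complex) \<Rightarrow> nat \<Rightarrow> (int \<Rightarrow> complex) \<Rightarrow> (nat \<Rightarrow> int) \<Rightarrow> complex" where
  "tuple_term w r \<beta> s = (\<Prod>j=1..r. w j (s j)) * (\<Prod>j=1..<r. rfac (s j - s (j + 1))) * \<beta> (s r)"

text \<open>The iterate at \<open>N\<close> is the sum of \<open>rfac (N - s_1)\<close> times the
  tuple term; this factor is bounded and tends to 1/(q)_inf, so dominated convergence
  applies.\<close>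

lemma bailey_iter_LIMSEQ:
  assumes r: "r \<ge> 1"
    and w: "\<And>j. j \<in> {1..r} \<Longrightarrow> (\<lambda>l. norm (w j l)) summable_on {L..}"
    and \<beta>: "\<And>n. n \<ge> L \<Longrightarrow> norm (\<beta> n) \<le> K"
  shows "tuple_term w r \<beta> summable_on PiE {1..r} (\<lambda>_. {L..})"
    and "(\<lambda>N. bailey_iter L w r \<beta> (int N))
           \<longlonglongrightarrow> infsum (tuple_term w r \<beta>) (PiE {1..r} (\<lambda>_. {L..})) / qpoch_inf q q"
proof -
  let ?D = "PiE {1..r} (\<lambda>_. {L..})"
  let ?t = "tuple_term w r \<beta>"
  let ?f = "\<lambda>N s. rfac (int N - s 1) * ?t s"
  obtain C where C: "C > 0" "\<And>n. norm (rfac n) \<le> C" using rfac_bounded by blast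
  \<comment> \<open>One \<open>C\<close> for each of the \<open>r\<close> reciprocal factorials,
    \<open>K\<close> for \<open>\<beta>\<close>, and a product of one-variable weights, summable
    over the product set because each of them is.\<close>
  define W where "W s = C * ((\<Prod>j=1..r. norm (w j (s j))) * C ^ (r - 1) * K)" for s
  have K: "K \<ge> 0" using \<beta>[of L] norm_ge_zero[of "\<beta> L"] by linarith
  have bound: "norm (?f N s) \<le> W s" if s: "s \<in> ?D" for N s
  proof -
    have "norm (\<Prod>j=1..<r. rfac (s j - s (j + 1))) \<le> (\<Prod>j=1..<r. C)"
      unfolding prod_norm[symmetric] using C by (intro prod_mono) auto
    also have "\<dots> = C ^ (r - 1)" by simp
    finally have 1: "norm (\<Prod>j=1..<r. rfac (s j - s (j + 1))) \<le> C ^ (r - 1)" .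
    have 2: "norm (\<beta> (s r)) \<le> K" using s r by (intro \<beta>) (auto simp: PiE_def Pi_def)
    show ?thesis
      unfolding W_def tuple_term_def norm_mult prod_norm
      using C K 1 2 by (intro mult_mono mult_nonneg_nonneg) (auto intro: order_trans[OF norm_ge_zero])
  qed
  have "Infinite_Set_Sum.abs_summable_on (\<lambda>s. \<Prod>j=1..r. norm (w j (s j))) ?D"
  proof (rule Infinite_Set_Sum.abs_summable_on_prod_PiE)
    show "Infinite_Set_Sum.abs_summable_on (\<lambda>l. norm (w j l)) {L..}" if "j \<in> {1..r}" for j
      using w[OF that] by (simp flip: abs_summable_equivalent)
  qed auto
  then have "(\<lambda>s. \<Prod>j=1..r. norm (w j (s j))) summable_on ?D"
    by (rule abs_summable_summable[OF abs_summable_equivalent[THEN iffD2]])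
  then have Ws: "W summable_on ?D"
    unfolding W_def mult.assoc by (intro summable_on_cmult_right summable_on_cmult_left)
  have lim: "(\<lambda>N. ?f N s) \<longlonglongrightarrow> 1 / qpoch_inf q q * ?t s" for s
    using rfac_LIMSEQ[of "- s 1"] by (intro tendsto_intros) auto
  have fin: "infsum (?f N) ?D = bailey_iter L w r \<beta> (int N)" for N
  proof -
    \<comment> \<open>A nonzero term forces s_1 \<le> N and a descending tuple, so only the finite
      box contributes.\<close>
    have "infsum (?f N) ?D = infsum (?f N) (PiE {1..r} (\<lambda>_. {L..int N}))"
    proof (rule infsum_cong_neutral)
      fix s assume s: "s \<in> ?D - PiE {1..r} (\<lambda>_. {L..int N})"
      show "?f N s = 0"
      proof (rule ccontr)
        assume nz: "?f N s \<noteq> 0"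
        then have 1: "s 1 \<le> int N" by (cases "int N - s 1 < 0") auto
        have desc: "s (j + 1) \<le> s j" if "j \<in> {1..<r}" for j
        proof (rule ccontr)
          assume "\<not> s (j + 1) \<le> s j"
          then have "rfac (s j - s (j + 1)) = 0" by simp
          then have "(\<Prod>j=1..<r. rfac (s j - s (j + 1))) = 0" using that by (subst prod_zero_iff) auto
          then show False using nz by (simp add: tuple_term_def)
        qed
        have "s j \<le> s 1" if "j \<in> {1..r}" for j
          by (rule descending_le[of r s, OF desc]) (use that in auto)
        then have "s j \<le> int N" if "j \<in> {1..r}" for j using that 1 by force
        then show False using s by (auto simp: PiE_iff)
      qed
    qed (auto simp: PiE_iff)
    also have "\<dots> = (\<Sum>s\<in>PiE {1..r} (\<lambda>_. {L..int N}). ?f N s)"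
      by (intro infsum_finite finite_PiE) auto
    also have "\<dots> = bailey_iter L w r \<beta> (int N)"
      unfolding bailey_iter_eq_sum[symmetric]
    proof (rule sum.cong)
      fix s
      have "(\<Prod>j=1..r. rfac ((s(0 := int N)) (j - 1) - s j))
          = rfac (int N - s 1) * (\<Prod>j=1..<r. rfac (s j - s (j + 1)))"
      proof -
        have "{1..r} = insert 1 {2..r}" using r by auto
        then have "(\<Prod>j=1..r. rfac ((s(0 := int N)) (j - 1) - s j))
            = rfac (int N - s 1) * (\<Prod>j=2..r. rfac ((s(0 := int N)) (j - 1) - s j))"
          by simp
        also have "(\<Prod>j=2..r. rfac ((s(0 := int N)) (j - 1) - s j)) = (\<Prod>j=1..<r. rfac (s j - s (j + 1)))"
          by (rule prod.reindex_bij_witness[of _ "\<lambda>j. j + 1" "\<lambda>j. j - 1"]) auto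
        finally show ?thesis .
      qed
      then show "?f N s = (\<Prod>j=1..r. w j (s j) * rfac ((s(0 := int N)) (j - 1) - s j)) * \<beta> ((s(0 := int N)) r)"
        using r by (simp add: prod.distrib tuple_term_def mult_ac)
    qed simp
    finally show ?thesis .
  qed
  have "(\<lambda>s. 1 / qpoch_inf q q * ?t s) summable_on ?D"
    by (rule dominated_convergence_infsum(2)[OF lim bound Ws])
  then show "?t summable_on ?D"
    using summable_on_cmult_right'[of "1 / qpoch_inf q q" ?t ?D] qpoch_inf_nonzero by simp
  have "(\<lambda>N. infsum (?f N) ?D) \<longlonglongrightarrow> infsum (\<lambda>s. 1 / qpoch_inf q q * ?t s) ?D"
    by (rule dominated_convergence_infsum(1)[OF lim bound Ws])
  then show "(\<lambda>N. bailey_iter L w r \<beta> (int N)) \<longlonglongrightarrow> infsum ?t ?D / qpoch_inf q q"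
    unfolding fin by (subst (asm) infsum_cmult_right') simp
qed

section \<open>Bailey steps acting on kernels\<close>

lemma bailey_step_kernel:
  fixes m :: nat
  assumes w: "\<And>k. (\<Sum>l=L..n. w l * rfac (n - l) * \<phi> k l) = d k * \<psi> k"
    and \<phi>: "\<And>k l. k \<notin> {- int m - l..l} \<Longrightarrow> \<phi> k l = 0"
  shows "bailey_step L w (\<lambda>l. \<Sum>k=-int m-l..l. c k * \<phi> k l) n = (\<Sum>k=-int m-n..n. c k * d k * \<psi> k)"
proof -
  have "bailey_step L w (\<lambda>l. \<Sum>k=-int m-l..l. c k * \<phi> k l) n
      = (\<Sum>l=L..n. w l * rfac (n - l) * (\<Sum>k=-int m-n..n. c k * \<phi> k l))"
  proof -
    \<comment> \<open>For l \<le> n the range of \<open>k\<close> widens to that of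
      \<open>n\<close>, as the kernel vanishes on the added indices; then the sums can be
      exchanged.\<close>
    have "(\<Sum>k=-int m-l..l. c k * \<phi> k l) = (\<Sum>k=-int m-n..n. c k * \<phi> k l)" if "l \<in> {L..n}" for l
      using that by (intro sum.mono_neutral_left) (auto intro!: \<phi>)
    then show ?thesis by (simp add: bailey_step_def)
  qed
  also have "\<dots> = (\<Sum>k=-int m-n..n. \<Sum>l=L..n. c k * (w l * rfac (n - l) * \<phi> k l))"
    unfolding sum_distrib_left by (subst sum.swap) (simp add: mult_ac)
  also have "\<dots> = (\<Sum>k=-int m-n..n. c k * d k * \<psi> k)"
    by (simp only: sum_distrib_left[symmetric] w) (simp only: mult.assoc)
  finally show ?thesis .
qed

text \<open>With x = q^(m+2k) this is the first kernel plus x + ... + x^b times the second,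
  \<open>b\<close> counting the steps with weight q^(l^2+ml-l). Both kernels have the same limit in
  \<open>n\<close>, which leaves 1 + x + ... + x^b.\<close>

definition lattice_kernel :: "nat \<Rightarrow> nat \<Rightarrow> int \<Rightarrow> int \<Rightarrow> complex" where
  "lattice_kernel m b k n = rfac (n - k) * rfac (int m + n + k)
     + (\<Sum>u=1..b. q powi (int u * (int m + 2 * k))) * (rfac (n - k - 1) * rfac (int m + n + k))"

lemma lattice_kernel_0: "lattice_kernel m 0 k n = rfac (n - k) * rfac (int m + n + k)"
  by (simp add: lattice_kernel_def)

lemma lattice_kernel_eq_0: "k \<notin> {- int m - n..n} \<Longrightarrow> lattice_kernel m b k n = 0"
  by (cases "n < k") (auto simp: lattice_kernel_def)

lemma lattice_kernel_chain:
  "(\<Sum>l=-int (m div 2)..n. q powi (l\<^sup>2 + int m * l) * rfac (n - l) * lattice_kernel m 0 k l)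
    = q powi (k\<^sup>2 + int m * k) * lattice_kernel m 0 k n"
  unfolding lattice_kernel_0 by (rule q_Vandermonde) linarith

text \<open>Up to the common eigenvalue the step sends the second kernel g to x g and the first
  kernel h to h + x g. A coefficient G of g becomes x (1 + G), which extends x + ... + x^b by one
  term.\<close>

lemma lattice_kernel_step:
  "(\<Sum>l=-int (m div 2)..n. q powi (l\<^sup>2 + int m * l - l) * rfac (n - l) * lattice_kernel m b k l)
    = q powi (k\<^sup>2 + int m * k - k) * lattice_kernel m (Suc b) k n"
proof -
  let ?L = "- int (m div 2)"
  let ?S = "\<lambda>f. \<Sum>l=?L..n. q powi (l\<^sup>2 + int m * l - l) * rfac (n - l) * f l"
  let ?h = "\<lambda>l. rfac (l - k) * rfac (int m + l + k)"
  let ?g = "\<lambda>l. rfac (l - k - 1) * rfac (int m + l + k)"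
  let ?x = "q powi (int m + 2 * k)"
  let ?e = "q powi (k\<^sup>2 + int m * k - k)"
  define G where "G = (\<Sum>u=1..b. q powi (int u * (int m + 2 * k)))"
  \<comment> \<open>The second kernel is the first with m - 1 and k + 1 for m and k, and m - 1 also
    fits the weight, so q-Vandermonde applies directly.\<close>
  have g: "?S ?g = ?e * ?x * ?g n"
  proof -
    have "?S ?g = (\<Sum>l=?L..n. q powi (l\<^sup>2 + (int m - 1) * l) * rfac (n - l)
        * (rfac (l - (k + 1)) * rfac (int m - 1 + l + (k + 1))))"
      by (simp add: algebra_simps)
    also have "\<dots> = q powi ((k + 1)\<^sup>2 + (int m - 1) * (k + 1))
        * (rfac (n - (k + 1)) * rfac (int m - 1 + n + (k + 1)))"
      by (rule q_Vandermonde) linarith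
    also have "q powi ((k + 1)\<^sup>2 + (int m - 1) * (k + 1)) = ?e * ?x"
      by (simp add: powi_mult algebra_simps power2_eq_square)
    finally show ?thesis by (simp add: algebra_simps)
  qed
  \<comment> \<open>Splitting \<open>q^(-l) = q^(-k) + q^(-l) (1 - q^(l-k))\<close> and cancelling \<open>1 - q^(l-k)\<close> against
    \<open>(q)_(l-k)\<close> avoids the division by \<open>1 - q^(m+2k)\<close> of the usual Bailey lattice, which
    breaks down at \<open>k = -m/2\<close>.\<close>
  have h: "?S ?h = ?e * (?h n + ?x * ?g n)"
  proof -
    have "q powi (l\<^sup>2 + int m * l - l) * rfac (n - l) * ?h l
      = q powi (- k) * (q powi (l\<^sup>2 + int m * l) * rfac (n - l) * ?h l)
        + q powi (l\<^sup>2 + int m * l - l) * rfac (n - l) * ?g l" for l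
    proof -
      have 1: "rfac (l - k - 1) = (1 - q powi (l - k)) * rfac (l - k)"
        by (rule rfac_rec[symmetric])
      have "q powi (- k) * q powi (l\<^sup>2 + int m * l) = q powi (l\<^sup>2 + int m * l - l) * q powi (l - k)"
        by (simp add: powi_mult algebra_simps)
      then have 2: "q powi (- k) * (q powi (l\<^sup>2 + int m * l) * rfac (n - l) * ?h l)
          = q powi (l\<^sup>2 + int m * l - l) * q powi (l - k) * rfac (n - l) * ?h l"
        by (simp only: mult.assoc[symmetric])
      show ?thesis unfolding 1 2 by (simp add: algebra_simps)
    qed
    then have "?S ?h = q powi (- k) * (\<Sum>l=?L..n. q powi (l\<^sup>2 + int m * l) * rfac (n - l) * ?h l) + ?S ?g"
      by (simp only: sum.distrib sum_distrib_left)
    also have "\<dots> = q powi (- k) * (q powi (k\<^sup>2 + int m * k) * ?h n) + ?e * ?x * ?g n"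
      using g q_Vandermonde[of ?L "int m" n k] by simp
    also have "q powi (- k) * (q powi (k\<^sup>2 + int m * k) * ?h n) = ?e * ?h n"
      by (simp add: powi_mult_left)
    finally show ?thesis by (simp add: algebra_simps)
  qed
  have G: "(\<Sum>u=1..Suc b. q powi (int u * (int m + 2 * k))) = ?x * (1 + G)"
  proof -
    have "(\<Sum>u=1..Suc b. q powi (int u * (int m + 2 * k))) = (\<Sum>u=0..b. q powi (int (Suc u) * (int m + 2 * k)))"
      using sum.shift_bounds_cl_Suc_ivl[of "\<lambda>u. q powi (int u * (int m + 2 * k))" 0 b] by simp
    also have "\<dots> = ?x * (\<Sum>u=0..b. q powi (int u * (int m + 2 * k)))"
      by (simp add: sum_distrib_left powi_mult algebra_simps)
    also have "(\<Sum>u=0..b. q powi (int u * (int m + 2 * k))) = 1 + G"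
      by (simp add: G_def sum.atLeast_Suc_atMost)
    finally show ?thesis .
  qed
  have "?S (lattice_kernel m b k) = ?S ?h + G * ?S ?g"
    unfolding sum_distrib_left sum.distrib[symmetric]
    by (intro sum.cong refl) (simp add: lattice_kernel_def G_def algebra_simps)
  then show ?thesis
    unfolding g h lattice_kernel_def G by (simp add: algebra_simps)
qed

text \<open>The pair after \<open>a\<close> steps with weight q^(l^2+ml) and then \<open>b\<close>
  steps with the extra -l; each step adds its eigenvalue to the exponent.\<close>

definition bailey_beta :: "nat \<Rightarrow> nat \<Rightarrow> nat \<Rightarrow> int \<Rightarrow> complex" where
  "bailey_beta m a b n = (\<Sum>k=-int m-n..n.
     theta_coeff k * q powi (int (a + b) * (k\<^sup>2 + int m * k) - int b * k) * lattice_kernel m b k n)"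

text \<open>At \<open>b = 0\<close> only the first kernel is present, an exact eigenfunction; in the
  iteration these steps come first.\<close>

lemma bailey_beta_chain:
  "bailey_step (- int (m div 2)) (\<lambda>l. q powi (l\<^sup>2 + int m * l)) (bailey_beta m a 0) = bailey_beta m (Suc a) 0"
proof
  fix n
  show "bailey_step (- int (m div 2)) (\<lambda>l. q powi (l\<^sup>2 + int m * l)) (bailey_beta m a 0) n = bailey_beta m (Suc a) 0 n"
    unfolding bailey_beta_def
    by (subst bailey_step_kernel[OF lattice_kernel_chain lattice_kernel_eq_0])
       (simp_all add: powi_mult mult.assoc algebra_simps)
qed

lemma bailey_beta_step:
  "bailey_step (- int (m div 2)) (\<lambda>l. q powi (l\<^sup>2 + int m * l - l)) (bailey_beta m a b) = bailey_beta m a (Suc b)"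
proof
  fix n
  show "bailey_step (- int (m div 2)) (\<lambda>l. q powi (l\<^sup>2 + int m * l - l)) (bailey_beta m a b) n = bailey_beta m a (Suc b) n"
    unfolding bailey_beta_def
    by (subst bailey_step_kernel[OF lattice_kernel_step lattice_kernel_eq_0])
       (simp_all add: powi_mult mult.assoc algebra_simps)
qed

definition weight :: "nat \<Rightarrow> nat \<Rightarrow> nat \<Rightarrow> int \<Rightarrow> complex" where
  "weight m i j l = q powi (l\<^sup>2 + int m * l - (if j \<le> i then l else 0))"

lemma bailey_iter_weight_le:
  "r \<le> i \<Longrightarrow> bailey_iter (- int (m div 2)) (weight m i) r (bailey_beta m a b) = bailey_beta m a (b + r)"
proof (induction r arbitrary: b)
  case (Suc r)
  then show ?case using Suc.IH[of "Suc b"] by (simp add: weight_def[abs_def] bailey_beta_step)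
qed simp

text \<open>The indices above \<open>i\<close> act first and are plain steps; the remaining
  \<open>i\<close> steps carry the extra -l.\<close>

lemma bailey_iter_weight:
  "bailey_iter (- int (m div 2)) (weight m i) (i + a') (bailey_beta m a 0) = bailey_beta m (a + a') i"
proof (induction a' arbitrary: a)
  case 0
  then show ?case using bailey_iter_weight_le[of i i] by simp
next
  case (Suc a')
  then show ?case using Suc.IH[of "Suc a"] by (simp add: weight_def[abs_def] bailey_beta_chain)
qed

section \<open>Limit of the iterated pair and its theta series\<close>

lemma kernel_sum_LIMSEQ:
  fixes m :: nat
  assumes c: "(\<lambda>k. norm (c k)) summable_on UNIV" and d: "d \<ge> 0"
  shows "(\<lambda>N. \<Sum>k=-int m-int N..int N. c k * (rfac (int N - k - d) * rfac (int m + int N + k)))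
    \<longlonglongrightarrow> infsum c UNIV / (qpoch_inf q q)\<^sup>2"
proof -
  let ?f = "\<lambda>N k. c k * (rfac (int N - k - d) * rfac (int m + int N + k))"
  obtain C where C: "C > 0" "\<And>n. norm (rfac n) \<le> C" using rfac_bounded by blast
  \<comment> \<open>The offset \<open>d\<close>, 0 for the first kernel and 1 for the second, is
    lost in the limit.\<close>
  have 1: "(\<lambda>N. rfac (int N - k - d)) \<longlonglongrightarrow> 1 / qpoch_inf q q" for k
    using rfac_LIMSEQ[of "- k - d"] by (simp add: algebra_simps)
  have 2: "(\<lambda>N. rfac (int m + int N + k)) \<longlonglongrightarrow> 1 / qpoch_inf q q" for k
    using rfac_LIMSEQ[of "int m + k"] by (simp add: algebra_simps)
  have lim: "(\<lambda>N. ?f N k) \<longlonglongrightarrow> c k * (1 / qpoch_inf q q * (1 / qpoch_inf q q))" for k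
    by (intro tendsto_intros 1 2)
  have bound: "norm (?f N k) \<le> norm (c k) * (C * C)" for N k
    using C by (subst norm_mult, subst norm_mult) (intro mult_left_mono mult_mono, auto)
  have w: "(\<lambda>k. norm (c k) * (C * C)) summable_on UNIV"
    by (intro summable_on_cmult_left c)
  have eq: "infsum (?f N) UNIV = (\<Sum>k=-int m-int N..int N. ?f N k)" for N
  proof -
    have "infsum (?f N) UNIV = infsum (?f N) {-int m-int N..int N}"
    proof (rule infsum_cong_neutral)
      fix k assume "k \<in> UNIV - {-int m-int N..int N}"
      then have "int N - k - d < 0 \<or> int m + int N + k < 0" using d by auto
      then show "?f N k = 0" by auto
    qed auto
    then show ?thesis by simp
  qed
  have "(\<lambda>N. infsum (?f N) UNIV) \<longlonglongrightarrow> (\<Sum>\<^sub>\<infinity>k. c k * (1 / qpoch_inf q q * (1 / qpoch_inf q q)))"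
    by (rule dominated_convergence_infsum(1)[OF lim bound w])
  also have "(\<Sum>\<^sub>\<infinity>k. c k * (1 / qpoch_inf q q * (1 / qpoch_inf q q))) = infsum c UNIV / (qpoch_inf q q)\<^sup>2"
    by (subst infsum_cmult_left') (simp add: power2_eq_square)
  finally show ?thesis unfolding eq .
qed

text \<open>The exponent k(k-1)/2 + r(k^2+mk) - ik + u(m+2k) equals (2r+1) k(k-1)/2 + k((m+1)r - i +
  2u) + mu, so this is q^(mu) times the Jacobi series with base q^(2r+1) and argument
  \<open>z\<close>.\<close>

lemma theta_series:
  fixes m r i u :: nat
  defines "z \<equiv> q powi ((int m + 1) * int r - int i + 2 * int u)"
    and "c \<equiv> \<lambda>k. theta_coeff k * q powi (int r * (k\<^sup>2 + int m * k) - int i * k + int u * (int m + 2 * k))"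
  shows "(\<lambda>k. norm (c k)) summable_on UNIV"
    and "infsum c UNIV = q ^ (m * u) * qpoch_inf_list [q ^ (2 * r + 1), z,
           q powi ((1 - int m) * int r + int i - 2 * int u + 1)] (q ^ (2 * r + 1))"
proof -
  define p where "p = q ^ (2 * r + 1)"
  have "norm (q ^ (2 * r + 1)) < 1"
    using norm_q power_strict_mono[of "norm q" 1 "2 * r + 1"] by (simp only: norm_power) simp
  then interpret P: nome p
    using q_nonzero by unfold_locales (auto simp: p_def)
  have z: "z \<noteq> 0" using q_nonzero by (simp add: z_def)
  have c: "c k = q ^ (m * u) * (P.theta_coeff k * z powi k)" for k
  proof -
    have "p powi (k * (k - 1) div 2) = q powi (int (2 * r + 1) * (k * (k - 1) div 2))"
      unfolding p_def by (rule power_int_power)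
    moreover have "int (2 * r + 1) * (k * (k - 1) div 2) = int r * (2 * (k * (k - 1) div 2)) + k * (k - 1) div 2"
      by (simp add: algebra_simps)
    moreover have "2 * (k * (k - 1) div 2) = k * (k - 1)" by simp
    ultimately have 1: "p powi (k * (k - 1) div 2) = q powi (int r * (k * (k - 1)) + k * (k - 1) div 2)"
      by simp
    have 2: "z powi k = q powi (((int m + 1) * int r - int i + 2 * int u) * k)"
      by (simp add: z_def power_int_mult)
    have 3: "q ^ (m * u) = q powi (int m * int u)"
      by (simp flip: of_nat_mult)
    have "q powi (k * (k - 1) div 2) * q powi (int r * (k\<^sup>2 + int m * k) - int i * k + int u * (int m + 2 * k))
        = q ^ (m * u) * (p powi (k * (k - 1) div 2) * z powi k)"
      unfolding 1 2 3 powi_mult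
      by (intro arg_cong[where f = "\<lambda>e. q powi e"]) (simp add: algebra_simps power2_eq_square)
    then show ?thesis unfolding c_def theta_coeff_def P.theta_coeff_def
      by (simp only: mult_ac)
  qed
  show "(\<lambda>k. norm (c k)) summable_on UNIV"
    unfolding c norm_mult[of "q ^ (m * u)"]
    by (intro summable_on_cmult_right P.summable_on_theta z)
  have pz: "p / z = q powi ((1 - int m) * int r + int i - 2 * int u + 1)"
  proof -
    have "p = q powi int (2 * r + 1)" by (simp only: p_def power_int_of_nat)
    then have "p / z = q powi (int (2 * r + 1) - ((int m + 1) * int r - int i + 2 * int u))"
      by (simp only: z_def power_int_diff[OF disjI1[OF q_nonzero]])
    then show ?thesis by (simp add: algebra_simps)
  qed
  have "c = (\<lambda>k. q ^ (m * u) * (P.theta_coeff k * z powi k))"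
    by (rule ext) (rule c)
  then have "infsum c UNIV = q ^ (m * u) * (\<Sum>\<^sub>\<infinity>k. P.theta_coeff k * z powi k)"
    by (simp only: infsum_cmult_right')
  also have "(\<Sum>\<^sub>\<infinity>k. P.theta_coeff k * z powi k) = qpoch_inf_list [p, z, p / z] p"
    using infsumI[OF P.Jacobi_triple_product[OF z]]
    by (simp only: qpoch_inf_list_def list.map prod_list.Cons prod_list.Nil mult_1_right mult.assoc)
  finally show "infsum c UNIV = q ^ (m * u) * qpoch_inf_list [q ^ (2 * r + 1), z,
           q powi ((1 - int m) * int r + int i - 2 * int u + 1)] (q ^ (2 * r + 1))"
    unfolding pz unfolding p_def .
qed

lemma bailey_beta_LIMSEQ:
  fixes m a i :: nat
  defines "r \<equiv> a + i"
  shows "(\<lambda>N. bailey_beta m a i (int N)) \<longlonglongrightarrow>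
    (\<Sum>k=0..i. q ^ (m * k) * qpoch_inf_list
       [q ^ (2 * r + 1), q powi ((int m + 1) * int r - int i + 2 * int k),
        q powi ((1 - int m) * int r + int i - 2 * int k + 1)] (q ^ (2 * r + 1))) / (qpoch_inf q q)\<^sup>2"
proof -
  define c where "c u k = theta_coeff k * q powi (int r * (k\<^sup>2 + int m * k) - int i * k + int u * (int m + 2 * k))" for u :: nat and k
  have c_summable: "(\<lambda>k. norm (c u k)) summable_on UNIV" for u
    unfolding c_def by (rule theta_series(1))
  have "c u = (\<lambda>k. theta_coeff k * q powi (int r * (k\<^sup>2 + int m * k) - int i * k + int u * (int m + 2 * k)))" for u
    by (rule ext) (rule c_def)
  then have c_infsum: "infsum (c u) UNIV = q ^ (m * u) * qpoch_inf_list
       [q ^ (2 * r + 1), q powi ((int m + 1) * int r - int i + 2 * int u),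
        q powi ((1 - int m) * int r + int i - 2 * int u + 1)] (q ^ (2 * r + 1))" for u
    by (simp only: theta_series(2))
  \<comment> \<open>Index u = 0 stands for the first kernel, u \<ge> 1 for the term q^(u(m+2k)) of
    the second; \<open>d\<close> is the offset between the two.\<close>
  define d where "d u = (if u = 0 then 0 else 1 :: int)" for u :: nat
  have eq: "bailey_beta m a i n = (\<Sum>u=0..i. \<Sum>k=-int m-n..n. c u k * (rfac (n - k - d u) * rfac (int m + n + k)))" for n
  proof -
    have "theta_coeff k * q powi (int (a + i) * (k\<^sup>2 + int m * k) - int i * k) * lattice_kernel m i k n
        = (\<Sum>u=0..i. c u k * (rfac (n - k - d u) * rfac (int m + n + k)))" for k
    proof -
      have c: "c u k = theta_coeff k * q powi (int r * (k\<^sup>2 + int m * k) - int i * k) * q powi (int u * (int m + 2 * k))" for u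
        by (simp add: c_def powi_mult mult.assoc)
      have "(\<Sum>u=0..i. c u k * (rfac (n - k - d u) * rfac (int m + n + k)))
        = c 0 k * (rfac (n - k) * rfac (int m + n + k))
          + (\<Sum>u=1..i. c u k * (rfac (n - k - 1) * rfac (int m + n + k)))"
        by (simp add: sum.atLeast_Suc_atMost d_def)
      then show ?thesis
        unfolding c lattice_kernel_def r_def
        by (simp only: sum_distrib_left[symmetric] sum_distrib_right[symmetric]) (simp add: algebra_simps)
    qed
    then show ?thesis
      unfolding bailey_beta_def by (subst sum.swap) simp
  qed
  have lim: "(\<lambda>N. \<Sum>u=0..i. \<Sum>k=-int m-int N..int N. c u k * (rfac (int N - k - d u) * rfac (int m + int N + k)))
    \<longlonglongrightarrow> (\<Sum>u=0..i. infsum (c u) UNIV / (qpoch_inf q q)\<^sup>2)"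
    by (intro tendsto_sum kernel_sum_LIMSEQ[where c = "c _"] c_summable) (simp add: d_def)
  show ?thesis
    unfolding eq sum_divide_distrib using lim unfolding c_infsum .
qed

section \<open>Assembly for nonzero q\<close>

lemma summable_on_weight: "(\<lambda>l. norm (weight m i j l)) summable_on {L..}"
proof -
  have "(\<lambda>l. norm q powi (l\<^sup>2 + int m * l - (if j \<le> i then l else 0))) summable_on UNIV"
  \<comment> \<open>The linear part of the exponent is at most (m + 1) |l| in absolute value;
    \<open>B\<close> is twice that.\<close>
  proof (rule summable_on_powi_quadratic[where B = "2 * int m + 2"])
    fix l :: int
    define a where "a = \<bar>l\<bar>"
    define t where "t = (if j \<le> i then l else 0)"
    define X where "X = int m * l"
    define Y where "Y = int m * a"
    have "- X \<le> Y"
      using abs_ge_minus_self[of X] by (simp add: X_def Y_def a_def abs_mult)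
    moreover have "0 \<le> l\<^sup>2" "t \<le> a" by (auto simp: a_def t_def)
    ultimately have "l\<^sup>2 - (2 * Y + 2 * a) \<le> 2 * l\<^sup>2 + 2 * X - 2 * t" by linarith
    moreover have "(2 * int m + 2) * a = 2 * Y + 2 * a" by (simp add: Y_def algebra_simps)
    ultimately have "l\<^sup>2 - (2 * int m + 2) * a \<le> 2 * (l\<^sup>2 + int m * l - t)" by (simp add: X_def)
    then show "l\<^sup>2 - (2 * int m + 2) * \<bar>l\<bar> \<le> 2 * (l\<^sup>2 + int m * l - (if j \<le> i then l else 0))"
      unfolding a_def t_def .
  qed (use q_nonzero norm_q in auto)
  then show ?thesis
    unfolding weight_def norm_power_int by (rule summable_on_subset_banach) simp
qed

text \<open>For n > 0 the lower index of the q-binomial exceeds the upper one and the term is 0;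
  only finitely many n from \<open>L\<close> to 0 remain.\<close>

lemma qbinom_theta_bounded:
  obtains K where "\<And>n. n \<ge> L \<Longrightarrow> norm (theta_coeff n * qbinom q (int m + n) (int m + 2 * n)) \<le> K"
proof -
  let ?b = "\<lambda>n. norm (theta_coeff n * qbinom q (int m + n) (int m + 2 * n))"
  have *: "?b n \<le> (\<Sum>n=L..0. ?b n)" if "n \<ge> L" for n
  proof (cases "n \<le> 0")
    case True
    then show ?thesis using that by (intro member_le_sum) auto
  next
    case False
    then show ?thesis by (simp add: qbinom_def sum_nonneg)
  qed
  show ?thesis by (rule that) (rule *)
qed

text \<open>\<open>bailey_beta m (r - i) i\<close> has two limits, the multiple sum over (q)_inf and
  the theta sums over (q)_inf^2; uniqueness of limits equates them.\<close>

lemma descending_tuples_has_sum: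
  assumes r: "r \<ge> 1" and i: "i \<le> r"
  shows "((\<lambda>s. q powi ((\<Sum>j=1..r. (s j)\<^sup>2) + int m * (\<Sum>j=1..r. s j) - (\<Sum>j=1..i. s j))
             / (\<Prod>j=1..<r. qpoch q q (s j - s (j + 1)))
             * (-1) powi (s r) * q powi (s r * (s r - 1) div 2)
             * qbinom q (int m + s r) (int m + 2 * s r))
          has_sum
          (\<Sum>k=0..i. q ^ (m * k) *
             (qpoch_inf_list
                [q ^ (2 * r + 1),
                 q powi ((int m + 1) * int r - int i + 2 * int k),
                 q powi ((1 - int m) * int r + int i - 2 * int k + 1)]
                (q ^ (2 * r + 1))
              / qpoch_inf q q)))
         (descending_tuples m r)"
    (is "(?f has_sum ?R) _")
proof -
  define L where "L = - int (m div 2)"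
  define \<beta> where "\<beta> n = theta_coeff n * qbinom q (int m + n) (int m + 2 * n)" for n
  let ?D = "PiE {1..r} (\<lambda>_. {L..})"
  let ?t = "tuple_term (weight m i) r \<beta>"
  obtain K where K: "\<And>n. n \<ge> L \<Longrightarrow> norm (\<beta> n) \<le> K"
    unfolding \<beta>_def using qbinom_theta_bounded by blast
  have "\<beta> = bailey_beta m 0 0"
    by (rule ext) (simp add: \<beta>_def bailey_beta_def bailey_beta_eq lattice_kernel_0)
  then have iter: "bailey_iter L (weight m i) r \<beta> = bailey_beta m (r - i) i"
    using bailey_iter_weight[of m i "r - i" 0] i by (simp add: L_def)
  have "(\<lambda>N. bailey_beta m (r - i) i (int N)) \<longlonglongrightarrow> infsum ?t ?D / qpoch_inf q q"
    using bailey_iter_LIMSEQ(2)[where w = "weight m i" and L = L and \<beta> = \<beta> and K = K, OF r summable_on_weight K] unfolding iter by simp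
  moreover have "(\<lambda>N. bailey_beta m (r - i) i (int N)) \<longlonglongrightarrow> ?R / qpoch_inf q q"
    using bailey_beta_LIMSEQ[of m "r - i" i] unfolding le_add_diff_inverse2[OF i] sum_divide_distrib power2_eq_square
    by (simp only: times_divide_eq_right divide_divide_eq_left)
  ultimately have "infsum ?t ?D / qpoch_inf q q = ?R / qpoch_inf q q"
    by (rule LIMSEQ_unique)
  then have inf: "infsum ?t ?D = ?R" using qpoch_inf_nonzero by simp
  have summable: "?t summable_on ?D"
    by (rule bailey_iter_LIMSEQ(1)[where w = "weight m i" and L = L and \<beta> = \<beta> and K = K, OF r summable_on_weight K])
  have "(?t has_sum ?R) ?D" using has_sum_infsum[OF summable] by (simp only: inf)
  \<comment> \<open>A tuple of the product set that is not descending has a vanishing reciprocal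
    factorial; a descending one lies in the product set since all entries are at least s_r.\<close>
  moreover have "(?t has_sum ?R) ?D \<longleftrightarrow> (?f has_sum ?R) (descending_tuples m r)"
  proof (rule has_sum_cong_neutral)
    fix s assume s: "s \<in> descending_tuples m r - ?D"
    have "s r \<le> s j" if "j \<in> {1..r}" for j
      by (rule descending_le[of r s]) (use s that in \<open>auto simp: descending_tuples_def\<close>)
    moreover have "L \<le> s r" "s \<in> extensional {1..r}" using s by (auto simp: descending_tuples_def L_def)
    ultimately have "s \<in> ?D" by (auto simp: PiE_iff intro: order_trans)
    then show "?f s = 0" using s by simp
  next
    fix s assume s: "s \<in> ?D - descending_tuples m r"
    then have "s r \<ge> - int (m div 2)" using r by (auto simp: PiE_iff L_def)
    then obtain j where j: "j \<in> {1..<r}" "s j < s (j + 1)"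
      using s by (auto simp: descending_tuples_def PiE_iff not_le)
    then have "(\<Prod>j=1..<r. rfac (s j - s (j + 1))) = 0" by (subst prod_zero_iff) (auto intro!: bexI[of _ j])
    then show "?t s = 0" by (simp add: tuple_term_def)
  next
    fix s assume s: "s \<in> ?D \<inter> descending_tuples m r"
    have "(\<Sum>j=1..r. (s j)\<^sup>2) + int m * (\<Sum>j=1..r. s j) - (\<Sum>j=1..i. s j)
        = (\<Sum>j=1..r. (s j)\<^sup>2 + int m * s j - (if j \<le> i then s j else 0))"
    proof -
      have "(\<Sum>j=1..i. s j) = (\<Sum>j=1..r. if j \<le> i then s j else 0)"
        using i by (intro sum.mono_neutral_cong_left) auto
      then show ?thesis by (simp add: sum.distrib sum_subtractf sum_distrib_left)
    qed
    then have 1: "q powi ((\<Sum>j=1..r. (s j)\<^sup>2) + int m * (\<Sum>j=1..r. s j) - (\<Sum>j=1..i. s j)) = (\<Prod>j=1..r. weight m i j (s j))"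
      by (simp add: weight_def power_int_sum q_nonzero)
    have "(\<Prod>j=1..<r. qpoch q q (s j - s (j + 1))) = (\<Prod>j=1..<r. 1 / rfac (s j - s (j + 1)))"
      using s by (intro prod.cong qpoch_eq_rfac) (auto simp: descending_tuples_def)
    then have 2: "1 / (\<Prod>j=1..<r. qpoch q q (s j - s (j + 1))) = (\<Prod>j=1..<r. rfac (s j - s (j + 1)))"
      by (simp add: prod_dividef)
    show "?t s = ?f s"
      unfolding 1 tuple_term_def 2[symmetric] \<beta>_def theta_coeff_def by (simp add: mult_ac)
  qed
  ultimately show ?thesis by blast
qed

end

subsection \<open>The case \<open>q = 0\<close>\<close>

lemma qpoch_inf_0_right: "qpoch_inf x 0 = 1 - x"
proof -
  have "qpoch_inf x 0 = (\<Prod>j\<in>{0}. 1 - x * 0 ^ j)"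
    unfolding qpoch_inf_def by (rule prodinf_finite) auto
  then show ?thesis by simp
qed

lemma qpoch_0_0: "qpoch 0 0 k = 1"
  by (simp add: qpoch_def qpoch_inf_0_right)

lemma qbinom_0: "qbinom 0 N j = (if 0 \<le> j \<and> j \<le> N then 1 else 0)"
  by (simp add: qbinom_def qpoch_0_0)

text \<open>At q = 0 a power of q is 1 or 0 according to whether its exponent vanishes, and
  q-factorials are 1. Both sides count: tuples with s_r = 0 and total exponent 0 on the left,
  surviving k on the right.\<close>

lemma descending_tuples_has_sum_0:
  fixes m r i :: nat
  assumes m: "m = 0 \<or> (m = 1 \<and> i \<le> 1)" and r: "r \<ge> 2" and i: "i \<le> r"
  shows "((\<lambda>s. 0 powi ((\<Sum>j=1..r. (s j)\<^sup>2) + int m * (\<Sum>j=1..r. s j) - (\<Sum>j=1..i. s j))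
             / (\<Prod>j=1..<r. qpoch 0 0 (s j - s (j + 1)))
             * (-1) powi (s r) * 0 powi (s r * (s r - 1) div 2)
             * qbinom 0 (int m + s r) (int m + 2 * s r))
          has_sum
          (\<Sum>k=0..i. 0 ^ (m * k) *
             (qpoch_inf_list
                [0 ^ (2 * r + 1),
                 0 powi ((int m + 1) * int r - int i + 2 * int k),
                 0 powi ((1 - int m) * int r + int i - 2 * int k + 1)]
                (0 ^ (2 * r + 1))
              / qpoch_inf 0 0)))
         (descending_tuples m r)"
    (is "(?f has_sum ?R) _")
proof -
  define e where "e s j = (s j)\<^sup>2 + int m * s j - (if j \<le> i then s j else 0)" for s :: "nat \<Rightarrow> int" and j
  \<comment> \<open>The counted tuples are t ones followed by zeros. For m = 0 ones need j \<le> i,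
    and s_r = 0 needs t < r; for m = 1 only the zero tuple qualifies.\<close>
  define T where "T = (if m = 0 then min i (r - 1) else 0)"
  define st where "st t = (\<lambda>j\<in>{1..r}. if j \<le> t then 1 else 0 :: int)" for t
  have E: "(\<Sum>j=1..r. (s j)\<^sup>2) + int m * (\<Sum>j=1..r. s j) - (\<Sum>j=1..i. s j) = (\<Sum>j=1..r. e s j)" for s
  proof -
    have "(\<Sum>j=1..i. s j) = (\<Sum>j=1..r. if j \<le> i then s j else 0)"
      using i by (intro sum.mono_neutral_cong_left) auto
    then show ?thesis by (simp add: e_def sum.distrib sum_subtractf sum_distrib_left)
  qed
  have m2: "m div 2 = 0" using m by auto
  have f: "?f s = (if s r = 0 \<and> (\<Sum>j=1..r. e s j) = 0 then 1 else 0)" if "s \<in> descending_tuples m r" for s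
    using that unfolding E
    by (auto simp: descending_tuples_def m2 qpoch_0_0 qbinom_0 power_int_0_left_if)
  have nonneg: "0 \<le> s j" if "s \<in> descending_tuples m r" "j \<in> {1..r}" for s j
  proof -
    have "s r \<le> s j"
      by (rule descending_le[of r s]) (use that in \<open>auto simp: descending_tuples_def\<close>)
    then show ?thesis using that by (auto simp: descending_tuples_def m2)
  qed
  have sq: "x \<le> x\<^sup>2" if "0 \<le> x" for x :: int
    using that mult_right_mono[of 1 x x] by (cases "x = 0") (auto simp: power2_eq_square)
  have e_nonneg: "0 \<le> e s j" if "s \<in> descending_tuples m r" "j \<in> {1..r}" for s j
    using nonneg[OF that] sq[of "s j"] by (auto simp: e_def intro: add_increasing2)
  have e_0: "s j = 0 \<or> m = 0 \<and> j \<le> i \<and> s j = 1" if "0 \<le> s j" "e s j = 0" for s j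
  proof -
    consider "m = 0" "j \<le> i" | "m = 0" "\<not> j \<le> i" | "m = 1" "j \<le> i" | "m = 1" "\<not> j \<le> i"
      using m by blast
    then show ?thesis
    proof cases
      case 1
      then have "s j * (s j - 1) = 0" using that by (simp add: e_def power2_eq_square algebra_simps)
      then show ?thesis using 1 by auto
    next
      case 4
      then have "s j * (s j + 1) = 0" using that by (simp add: e_def power2_eq_square algebra_simps)
      then show ?thesis using that by auto
    qed (use that in \<open>auto simp: e_def\<close>)
  qed
  have st: "st t \<in> descending_tuples m r \<and> st t r = 0 \<and> (\<Sum>j=1..r. e (st t) j) = 0" if "t \<in> {0..T}" for t
  proof -
    have t: "t < r" using that r by (auto simp: T_def split: if_splits)
    have "e (st t) j = 0" if "j \<in> {1..r}" for j
      using that \<open>t \<in> {0..T}\<close> m by (auto simp: e_def st_def T_def split: if_splits)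
    then show ?thesis using t r by (auto simp: descending_tuples_def st_def m2)
  qed
  have "(?f has_sum (\<Sum>s\<in>st ` {0..T}. ?f s)) (descending_tuples m r)"
  proof (rule has_sum_finite_neutralI)
    show "st ` {0..T} \<subseteq> descending_tuples m r" using st by auto
    fix s assume s: "s \<in> descending_tuples m r - st ` {0..T}"
    show "?f s = 0"
    proof (rule ccontr)
      assume "?f s \<noteq> 0"
      then have s0: "s r = 0" "(\<Sum>j=1..r. e s j) = 0" using f[of s] s by (auto split: if_splits)
      then have "e s j = 0" if "j \<in> {1..r}" for j
        using that e_nonneg[of s] s by (subst (asm) sum_nonneg_eq_0_iff) auto
      then have s01: "s j = 0 \<or> m = 0 \<and> j \<le> i \<and> s j = 1" if "j \<in> {1..r}" for j
        using that e_0[of s j] nonneg[of s j] s by auto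
      \<comment> \<open>The length of the initial block of nonzero entries; t + 1 appears because
        tuples are indexed from 1.\<close>
      define t where "t = (LEAST t. s (t + 1) = 0)"
      have ex: "s (r - 1 + 1) = 0" using s0 r by simp
      have t0: "s (t + 1) = 0" unfolding t_def by (rule LeastI[of _ "r - 1"]) (rule ex)
      have tr: "t \<le> r - 1" unfolding t_def by (rule Least_le) (rule ex)
      have low: "s j = 1 \<and> m = 0 \<and> j \<le> i" if "j \<in> {1..t}" for j
      proof -
        have "j - 1 < t" using that by auto
        then have "s (j - 1 + 1) \<noteq> 0" unfolding t_def by (rule not_less_Least)
        then show ?thesis using s01[of j] that tr by auto
      qed
      have high: "s j = 0" if "j \<in> {t + 1..r}" for j
      proof -
        have "s j \<le> s (t + 1)"
          by (rule descending_le[of r s]) (use s that in \<open>auto simp: descending_tuples_def\<close>)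
        then show ?thesis using nonneg[of s j] that s t0 by auto
      qed
      have "t \<in> {0..T}" using low[of t] tr by (cases "t = 0") (auto simp: T_def)
      moreover have "s = st t"
      proof
        fix j
        consider "j \<in> {1..t}" | "j \<in> {t + 1..r}" | "j \<notin> {1..r}" by force
        then show "s j = st t j"
          using low high s tr by cases (auto simp: st_def descending_tuples_def extensional_def)
      qed
      ultimately show False using s by blast
    qed
  qed auto
  moreover have "(\<Sum>s\<in>st ` {0..T}. ?f s) = ?R"
  proof -
    have inj: "inj_on st {0..T}"
    proof (rule linorder_inj_onI)
      fix a b assume ab: "a < b" "a \<in> {0..T}" "b \<in> {0..T}"
      then have "b \<in> {1..r}" using r by (auto simp: T_def split: if_splits)
      then have "st a b = 0" "st b b = 1" using ab by (auto simp: st_def)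
      then show "st a \<noteq> st b" by auto
    qed auto
    have "(\<Sum>s\<in>st ` {0..T}. ?f s) = (\<Sum>s\<in>st ` {0..T}. 1)"
    proof (rule sum.cong[OF refl])
      fix s assume "s \<in> st ` {0..T}"
      then have "s \<in> descending_tuples m r" "s r = 0" "(\<Sum>j=1..r. e s j) = 0" using st by auto
      then show "?f s = 1" using f[of s] by (simp only: if_True simp_thms)
    qed
    also have "\<dots> = of_nat (T + 1)" by (simp add: card_image[OF inj])
    \<comment> \<open>For m = 0 and i = r there are r + 1 values of k but r tuples: at k = 0 the
      second entry is q^0 = 1 and its product vanishes.\<close>
    also have "\<dots> = (\<Sum>k=0..i. if m * k = 0 \<and> \<not> (m = 0 \<and> i = r \<and> k = 0) then 1 else 0)"
    proof -
      have "card {k \<in> {0..i}. m * k = 0 \<and> \<not> (m = 0 \<and> i = r \<and> k = 0)} = T + 1"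
      proof -
        have "{k \<in> {0..i}. m * k = 0 \<and> \<not> (m = 0 \<and> i = r \<and> k = 0)}
            = (if m = 0 then if i = r then {1..r} else {0..i} else {0})"
          by auto
        then show ?thesis using i r by (auto simp: T_def)
      qed
      then show ?thesis by (simp flip: sum.inter_filter)
    qed
    also have "\<dots> = ?R"
    proof (rule sum.cong[OF refl])
      fix k assume k: "k \<in> {0..i}"
      \<comment> \<open>The third exponent is 0 only for m = i = k = 1, where q^(mk) is already
        0.\<close>
      have "(1 - int m) * int r + int i - 2 * int k + 1 \<noteq> 0 \<or> m * k \<noteq> 0"
        using m k i by auto
      moreover have "(int m + 1) * int r - int i + 2 * int k = 0 \<longleftrightarrow> m = 0 \<and> i = r \<and> k = 0"
        using m k i r by auto
      ultimately show "(if m * k = 0 \<and> \<not> (m = 0 \<and> i = r \<and> k = 0) then 1 else 0) =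
         0 ^ (m * k) *
             (qpoch_inf_list
                [0 ^ (2 * r + 1),
                 0 powi ((int m + 1) * int r - int i + 2 * int k),
                 0 powi ((1 - int m) * int r + int i - 2 * int k + 1)]
                (0 ^ (2 * r + 1))
              / qpoch_inf 0 0)"
        by (auto simp: qpoch_inf_list_def qpoch_inf_0_right power_int_0_left_if)
    qed
    finally show ?thesis .
  qed
  ultimately show ?thesis by simp
qed

text \<open>For q = 0 the second assumption lists exactly the cases without negative powers of q on
  the right: the third entry has its least exponent (1-m)r - i + 1 at k = i, nonnegative iff m = 0,
  or m = 1 and i \<le> 1.\<close>

theorem theorem1p20:
  fixes q :: complex and m r i :: nat
  assumes "norm q < 1"
    and "q \<noteq> 0 \<or> m = 0 \<or> (m = 1 \<and> i \<le> 1)"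
    and "r \<ge> 2" and "i \<le> r"
  shows "((\<lambda>s. q powi ((\<Sum>j=1..r. (s j)\<^sup>2) + int m * (\<Sum>j=1..r. s j) - (\<Sum>j=1..i. s j))
             / (\<Prod>j=1..<r. qpoch q q (s j - s (j + 1)))
             * (-1) powi (s r) * q powi (s r * (s r - 1) div 2)
             * qbinom q (int m + s r) (int m + 2 * s r))
          has_sum
          (\<Sum>k=0..i. q ^ (m * k) *
             (qpoch_inf_list
                [q ^ (2 * r + 1),
                 q powi ((int m + 1) * int r - int i + 2 * int k),
                 q powi ((1 - int m) * int r + int i - 2 * int k + 1)]
                (q ^ (2 * r + 1))
              / qpoch_inf q q)))
         (descending_tuples m r)"
proof (cases "q = 0")
  case True
  with assms(2) have "m = 0 \<or> (m = 1 \<and> i \<le> 1)" by simp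
  from descending_tuples_has_sum_0[OF this assms(3,4)] show ?thesis
    unfolding True .
next
  case False
  then interpret nome q using assms(1) by unfold_locales
  from assms(3) have "r \<ge> 1" by simp
  then show ?thesis by (rule descending_tuples_has_sum[OF _ assms(4)])
qed

end
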